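(* Let $\mathfrak{g}=\mathfrak{s}\ltimes_\phi R(\mathfrak{g})$ be a Levi decomposition of a finite-dimensional Lie algebra over an algebraically closed field $\mathbb{K}$ of characteristic zero. A product $\circ$ on $\mathfrak{g}$ defines an $A_{BD}$-structure if and only if there exist linear maps $F:\mathfrak{s}\to R(\mathfrak{g})$, $G:R(\mathfrak{g})\to R(\mathfrak{g})$ and $\Delta:R(\mathfrak{g})\to \mathrm{Der}(R(\mathfrak{g}))$ such that $$(a+r)\circ (a'+r')=\phi(a)F(a')+\phi(a)G(r')+\phi(a')G(r)+\Delta(r)(r')$$ for all $a,a'\in\mathfrak{s}$, $r,r'\in R(\mathfrak{g})$, where $F$, $G$ and $\Delta$ satisfy, for all $a,a'\in \mathfrak{s}$ and $r,r' \in R(\mathfrak{g})$: (1) $\phi(a)F(a')=\phi(a')F(a)$; (2) $\phi(a)G\in\mathrm{Der}(R(\mathfrak{g}))$; (3) $\Delta(r)(r')=\Delta(r')(r)$; (4) $\phi(a)G\phi(a')(r')=\phi(a')\phi(a)G(r')+[\phi(a)F(a'),r']$; (5) $\Delta(r)\phi(a')(r')=\phi(a')\Delta (r)(r')+[\phi(a')G(r),r']$.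
   Context: $R(\mathfrak{g})$ is the solvable radical of $\mathfrak{g}$, $\mathfrak{s}$ is a (semisimple) Levi subalgebra, and $\phi$ is the representation of $\mathfrak{s}$ on $R(\mathfrak{g})$ given by $\phi(a)=\mathrm{ad}(a)|_{R(\mathfrak{g})}$. $\mathrm{Der}(R(\mathfrak{g}))$ is the space of derivations of the Lie algebra $R(\mathfrak{g})$. An $A_{BD}$-structure on a Lie algebra $\mathfrak{g}$ is a commutative bilinear product $\circ:\mathfrak{g}\times\mathfrak{g}\to\mathfrak{g}$ with $x\circ[y,z]=[x\circ y,z]+[y,x\circ z]$ for all $x,y,z\in\mathfrak{g}$. *)

theory Defs
  imports "HOL-Computational_Algebra.Polynomial" "HOL-Library.FuncSet"
begin

locale lie_algebra = vector_space scale
  for scale :: "'k::field \<Rightarrow> 'g::ab_group_add \<Rightarrow> 'g"  (infixr \<open>*s\<close> 75) +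
  fixes br :: "'g \<Rightarrow> 'g \<Rightarrow> 'g"
  assumes br_linear_left: "Vector_Spaces.linear scale scale (\<lambda>x. br x y)"
    and br_linear_right: "Vector_Spaces.linear scale scale (\<lambda>y. br x y)"
    and br_self: "br x x = 0"
    and jacobi: "br x (br y z) + br y (br z x) + br z (br x y) = 0"
begin

definition subalgebra :: "'g set \<Rightarrow> bool" where
  "subalgebra L \<longleftrightarrow> subspace L \<and> (\<forall>x\<in>L. \<forall>y\<in>L. br x y \<in> L)"

definition ideal :: "'g set \<Rightarrow> 'g set \<Rightarrow> bool" where
  "ideal L I \<longleftrightarrow> subspace I \<and> I \<subseteq> L \<and> (\<forall>x\<in>L. \<forall>y\<in>I. br x y \<in> I)"

primrec derived_series :: "nat \<Rightarrow> 'g set \<Rightarrow> 'g set" where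
  "derived_series 0 L = L"
| "derived_series (Suc n) L =
     span {br x y | x y. x \<in> derived_series n L \<and> y \<in> derived_series n L}"

definition solvable :: "'g set \<Rightarrow> bool" where
  "solvable L \<longleftrightarrow> (\<exists>n. derived_series n L = {0})"

text \<open>The sum of all solvable ideals of \<open>L\<close>; by \<open>radical_greatest\<close> below it is, in finite
  dimension, the largest solvable ideal.\<close>

definition radical :: "'g set \<Rightarrow> 'g set" where
  "radical L = span (\<Union>{I. ideal L I \<and> solvable I})"

definition semisimple :: "'g set \<Rightarrow> bool" where
  "semisimple L \<longleftrightarrow> radical L = {0}"

definition levi_subalgebra :: "'g set \<Rightarrow> bool" where
  "levi_subalgebra \<s> \<longleftrightarrow> subalgebra \<s> \<and> semisimple \<s> \<and>
     \<s> \<inter> radical UNIV = {0} \<and> {a + r | a r. a \<in> \<s> \<and> r \<in> radical UNIV} = UNIV"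

text \<open>Linear maps between subspaces are total functions of which only the values on the source
  matter.\<close>

definition linear_on :: "'g set \<Rightarrow> 'g set \<Rightarrow> ('g \<Rightarrow> 'g) \<Rightarrow> bool" where
  "linear_on U V f \<longleftrightarrow> f \<in> U \<rightarrow> V \<and>
     (\<forall>x\<in>U. \<forall>y\<in>U. f (x + y) = f x + f y) \<and> (\<forall>c. \<forall>x\<in>U. f (c *s x) = c *s f x)"

definition Der :: "'g set \<Rightarrow> ('g \<Rightarrow> 'g) set" where
  "Der L = {d. linear_on L L d \<and> (\<forall>x\<in>L. \<forall>y\<in>L. d (br x y) = br (d x) y + br x (d y))}"

definition linear_into_Der :: "'g set \<Rightarrow> ('g \<Rightarrow> 'g \<Rightarrow> 'g) \<Rightarrow> bool" where
  "linear_into_Der L \<Delta> \<longleftrightarrow> \<Delta> \<in> L \<rightarrow> Der L \<and>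
     (\<forall>r\<in>L. \<forall>r'\<in>L. \<forall>x\<in>L. \<Delta> (r + r') x = \<Delta> r x + \<Delta> r' x) \<and>
     (\<forall>c. \<forall>r\<in>L. \<forall>x\<in>L. \<Delta> (c *s r) x = c *s \<Delta> r x)"

definition ad_radical :: "'g \<Rightarrow> 'g \<Rightarrow> 'g" where
  "ad_radical a = restrict (br a) (radical UNIV)"

definition ABD_structure :: "('g \<Rightarrow> 'g \<Rightarrow> 'g) \<Rightarrow> bool" where
  "ABD_structure p \<longleftrightarrow>
     (\<forall>x. Vector_Spaces.linear scale scale (\<lambda>y. p x y)) \<and>
     (\<forall>y. Vector_Spaces.linear scale scale (\<lambda>x. p x y)) \<and>
     (\<forall>x y. p x y = p y x) \<and>
     (\<forall>x y z. p x (br y z) = br (p x y) z + br y (p x z))"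

lemma br_simps:
  "br (x + y) z = br x z + br y z" "br x (y + z) = br x y + br x z"
  "br (c *s x) y = c *s br x y" "br x (c *s y) = c *s br x y"
  "br x 0 = 0" "br 0 y = 0"
proof -
  interpret l: Vector_Spaces.linear scale scale "\<lambda>x. br x y" for y by (rule br_linear_left)
  interpret r: Vector_Spaces.linear scale scale "\<lambda>y. br x y" for x by (rule br_linear_right)
  show "br (x + y) z = br x z + br y z" "br x (y + z) = br x y + br x z"
    "br (c *s x) y = c *s br x y" "br x (c *s y) = c *s br x y" "br x 0 = 0" "br 0 y = 0"
    by (rule l.add r.add l.scale r.scale l.zero r.zero)+
qed

lemma br_anticomm: "br x y = - br y x"
proof -
  have "br (x + y) (x + y) = br x y + br y x"
    unfolding br_simps by (simp add: br_self)
  then show ?thesis by (simp add: br_self eq_neg_iff_add_eq_0)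
qed

lemma ideal_right: "ideal L I \<Longrightarrow> x \<in> I \<Longrightarrow> y \<in> L \<Longrightarrow> br x y \<in> I"
  unfolding ideal_def by (metis br_anticomm subspace_neg)

lemma derived_series_mono: "K \<subseteq> L \<Longrightarrow> derived_series n K \<subseteq> derived_series n L"
proof (induction n)
  case (Suc n)
  then have "derived_series n K \<subseteq> derived_series n L" by blast
  then show ?case unfolding derived_series.simps by (intro span_mono) blast
qed simp

lemma derived_series_add: "derived_series (m + n) L = derived_series m (derived_series n L)"
  by (induction m) auto

lemma zero_in_derived_series: "0 \<in> L \<Longrightarrow> 0 \<in> derived_series n L"
  by (cases n) (auto intro: span_zero)

lemma ideal_sum:
  assumes L: "subspace L" and I: "ideal L I" and J: "ideal L J"
  shows "ideal L {x + y | x y. x \<in> I \<and> y \<in> J}"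
  unfolding ideal_def
proof (intro conjI ballI)
  show "subspace {x + y | x y. x \<in> I \<and> y \<in> J}"
    using I J by (intro subspace_sums) (auto simp: ideal_def)
  show "{x + y | x y. x \<in> I \<and> y \<in> J} \<subseteq> L"
    using I J L by (auto simp: ideal_def intro!: subspace_add)
next
  fix z w assume z: "z \<in> L" and "w \<in> {x + y | x y. x \<in> I \<and> y \<in> J}"
  then obtain x y where "w = x + y" "x \<in> I" "y \<in> J" by blast
  then have "br z w = br z x + br z y" "br z x \<in> I" "br z y \<in> J"
    using I J z by (simp_all add: ideal_def br_simps)
  then show "br z w \<in> {x + y | x y. x \<in> I \<and> y \<in> J}" by blast
qed

lemma solvable_sum:
  assumes I: "ideal L I" "solvable I" and J: "ideal L J" "solvable J"
  shows "solvable {x + y | x y. x \<in> I \<and> y \<in> J}"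
proof -
  let ?S = "\<lambda>A. {x + y | x y. x \<in> A \<and> y \<in> J}"
  have sJ: "subspace J" and sI: "subspace I" and IL: "I \<subseteq> L" and JL: "J \<subseteq> L"
    using I J by (auto simp: ideal_def)
  have sD: "subspace (derived_series n I)" for n by (cases n) (auto simp: sI)
  have DI: "derived_series n I \<subseteq> I" for n
  proof (induction n)
    case (Suc n)
    have "{br x y | x y. x \<in> derived_series n I \<and> y \<in> derived_series n I} \<subseteq> I"
      using I(1) subsetD[OF Suc] subsetD[OF IL] by (auto simp: ideal_def)
    then show ?case using sI by (simp add: span_minimal)
  qed simp
  have sub: "derived_series n (?S I) \<subseteq> ?S (derived_series n I)" for n
  proof (induction n)
    case (Suc n)
    have "br u v \<in> ?S (derived_series (Suc n) I)"
      if uv: "u \<in> derived_series n (?S I)" "v \<in> derived_series n (?S I)" for u v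
    proof -
      obtain x y where u: "u = x + y" "x \<in> derived_series n I" "y \<in> J"
        using subsetD[OF Suc uv(1)] by blast
      obtain x' y' where v: "v = x' + y'" "x' \<in> derived_series n I" "y' \<in> J"
        using subsetD[OF Suc uv(2)] by blast
      have "x \<in> L" "x' \<in> L" "y \<in> L"
        using u(2,3) v(2) DI IL JL by auto
      then have "br x y' \<in> J" "br y x' \<in> J" "br y y' \<in> J"
        using J(1) u(3) v(3) ideal_right[OF J(1)] by (simp_all add: ideal_def subsetD[OF JL])
      then have "br x y' + (br y x' + br y y') \<in> J"
        using sJ by (auto intro: subspace_add)
      moreover have "br x x' \<in> derived_series (Suc n) I"
        using u(2) v(2) by (auto intro: span_base)
      moreover have "br u v = br x x' + (br x y' + (br y x' + br y y'))"
        unfolding u(1) v(1) br_simps by (simp add: add_ac)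
      ultimately show ?thesis
        by (simp only: mem_Collect_eq) (intro exI conjI, rule refl)
    qed
    moreover have "subspace (?S (derived_series (Suc n) I))"
      by (rule subspace_sums[OF sD sJ])
    ultimately have "span {br u v | u v. u \<in> derived_series n (?S I) \<and> v \<in> derived_series n (?S I)}
        \<subseteq> ?S (derived_series (Suc n) I)"
      by (intro span_minimal subsetI) (elim CollectE exE conjE, simp only:)
    then show ?case by (simp only: derived_series.simps)
  qed simp
  obtain n m where n: "derived_series n I = {0}" and m: "derived_series m J = {0}"
    using I J by (auto simp: solvable_def)
  have "derived_series n (?S I) \<subseteq> J" using sub[of n] unfolding n by simp
  then have "derived_series m (derived_series n (?S I)) \<subseteq> derived_series m J"
    by (rule derived_series_mono)
  then have "derived_series (m + n) (?S I) \<subseteq> {0}"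
    by (simp only: derived_series_add m)
  moreover have "{0} \<subseteq> derived_series (m + n) (?S I)"
    by (simp only: insert_subset empty_subsetI simp_thms)
      (rule zero_in_derived_series[OF subspace_0[OF subspace_sums[OF sI sJ]]])
  ultimately have "derived_series (m + n) (?S I) = {0}"
    by (rule equalityI)
  then show ?thesis unfolding solvable_def by (rule exI)
qed

lemma radical_greatest:
  assumes "finite_dimensional_vector_space scale Basis" and L: "subalgebra L"
  shows "ideal L (radical L)" "solvable (radical L)"
    and "ideal L I \<Longrightarrow> solvable I \<Longrightarrow> I \<subseteq> radical L"
proof -
  interpret finite_dimensional_vector_space scale Basis by fact
  let ?P = "\<lambda>I. ideal L I \<and> solvable I"
  have sL: "subspace L" using L by (simp add: subalgebra_def)
  have "ideal L {0}" "derived_series 0 {0} = {0}"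
    using subspace_0[OF sL] by (auto simp: ideal_def br_simps)
  then have "?P {0}" unfolding solvable_def by (intro conjI exI)
  then have "\<exists>M. ?P M \<and> (\<forall>I. ?P I \<longrightarrow> dim I \<le> dim M)"
    by (rule ex_has_greatest_nat[where b = "Suc dimension"])
      (simp add: dim_subset_UNIV less_Suc_eq_le)
  then obtain M where M: "?P M" and max: "\<And>I. ?P I \<Longrightarrow> dim I \<le> dim M"
    by blast
  have sub: "I \<subseteq> M" if I: "?P I" for I
  proof -
    let ?S = "{x + y | x y. x \<in> M \<and> y \<in> I}"
    have P: "?P ?S" using M I sL by (auto intro: ideal_sum solvable_sum)
    have s: "subspace M" "subspace I" "subspace ?S" using M I P by (auto simp: ideal_def)
    have "M \<subseteq> ?S" "I \<subseteq> ?S"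
      using subspace_0[OF s(1)] subspace_0[OF s(2)] by force+
    moreover have "dim ?S \<le> dim M" using max P by blast
    ultimately show ?thesis using subspace_dim_equal[OF s(1,3)] by blast
  qed
  have "radical L = M"
    unfolding radical_def
  proof (rule antisym)
    show "span (\<Union>{I. ?P I}) \<subseteq> M"
      using M sub by (intro span_minimal) (auto simp: ideal_def)
    show "M \<subseteq> span (\<Union>{I. ?P I})" using M by (auto intro: span_base)
  qed
  then show "ideal L (radical L)" "solvable (radical L)"
    "ideal L I \<Longrightarrow> solvable I \<Longrightarrow> I \<subseteq> radical L"
    using M sub by auto
qed

end

end

theory Submission
  imports Defs
begin

text \<open>
  Write \<open>R\<close> for the radical of \<open>\<g>\<close> and \<open>p\<close> for the product.  If \<open>p\<close> is given by the displayed
  formula, then it is bilinear, and commutative by (1) and (3).  The Leibniz rule is trilinear and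
  skew in the two entries of the bracket, so it is enough to check it for entries in \<open>\<s>\<close> or in \<open>R\<close>
  (\<open>leibniz_of_components\<close>); there it reduces, case by case, to (1), (2), (4), (5), the derivation
  property of \<open>\<Delta> r\<close> and the Jacobi identity.

  Conversely, let \<open>p\<close> be an \<open>ABD\<close>-structure.  Two facts determine its shape.

  First, all products lie in \<open>R\<close> (\<open>ABD_structure_into_radical\<close>).  Let \<open>\<kappa>\<close> be the Killing form.  The
  form \<open>\<kappa>(p x y, z)\<close> is symmetric in \<open>x, y\<close>; as \<open>p x\<close> is a derivation, hence skew for \<open>\<kappa>\<close>, it is
  skew in \<open>y, z\<close>.  A form with both symmetries is zero.  So the products lie in the kernel of \<open>\<kappa>\<close>,
  which is a solvable ideal by Cartan's criterion (\<open>cartan_solvable\<close>).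

  Second, by the first fact the derivation \<open>p x\<close> restricts to a 1-cocycle of \<open>\<s>\<close> with values in the
  module \<open>R\<close>.  By the first Whitehead lemma (\<open>whitehead_first\<close>) it is a coboundary: there is a vector
  \<open>H x\<close> in \<open>R\<close> with \<open>p x a = [a, H x]\<close> for all \<open>a\<close> in \<open>\<s>\<close>, and \<open>H\<close> can be chosen linear
  (\<open>ABD_structure_inner_on_levi\<close>).  Then \<open>F\<close> and \<open>G\<close> are the restrictions of \<open>H\<close> to \<open>\<s>\<close> and \<open>R\<close>,
  \<open>\<Delta>\<close> is the restriction of \<open>p\<close> to \<open>R\<close>, and (1) to (5) are commutativity and the Leibniz rule.

  Most of the text proves the criterion and the lemma.  Both are needed only for modules that are
  subspaces of \<open>\<g>\<close> with the bracket as action, so everything is stated for a subalgebra \<open>L\<close> and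
  a subspace \<open>V\<close> with \<open>[L, V] \<subseteq> V\<close>.  The core of Cartan's criterion is that a perfect \<open>L\<close> whose trace
  form on \<open>V\<close> is zero acts trivially on \<open>V\<close>.  For \<open>x\<close> in \<open>L\<close>, let \<open>Y\<close> act on the generalised eigenspace
  of \<open>x\<close> with eigenvalue \<open>a\<close> as the rational scalar \<open>f a\<close>, where \<open>f\<close> is additive.  Then \<open>[Y, L] \<subseteq> L\<close>
  as operators on \<open>V\<close>, whence \<open>tr (x Y) = 0\<close> because \<open>L\<close> is perfect; but \<open>f\<close> maps this trace to a
  sum of the squares \<open>(f a)\<^sup>2\<close> with positive weights.  So all \<open>f a\<close> vanish, for every \<open>f\<close>, which makes
  \<open>x\<close> nilpotent on \<open>V\<close>, and Engel's theorem applies.  The Whitehead lemma is proved by induction on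
  the dimension of \<open>V\<close> with the Casimir operator of the trace form of \<open>V\<close>.
\<close>

section \<open>Linear operators\<close>

context finite_dimensional_vector_space
begin

abbreviation lin :: "('b \<Rightarrow> 'b) \<Rightarrow> bool" where
  "lin T \<equiv> Vector_Spaces.linear scale scale T"

lemma lin_simps:
  assumes "lin T"
  shows "T (x + y) = T x + T y" "T (x - y) = T x - T y" "T (- x) = - T x"
    "T (c *s x) = c *s T x" "T 0 = 0" "T (sum g A) = (\<Sum>i\<in>A. T (g i))"
proof -
  interpret Vector_Spaces.linear scale scale T by fact
  show "T (x + y) = T x + T y" "T (x - y) = T x - T y" "T (- x) = - T x"
    "T (c *s x) = c *s T x" "T 0 = 0" "T (sum g A) = (\<Sum>i\<in>A. T (g i))"
    by (rule add diff neg scale zero sum)+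
qed

lemma linI: "(\<And>x y. T (x + y) = T x + T y) \<Longrightarrow> (\<And>c x. T (c *s x) = c *s T x) \<Longrightarrow> lin T"
  using vector_space_axioms by (simp add: Vector_Spaces.linear_iff)

lemma lin_comp: "lin S \<Longrightarrow> lin T \<Longrightarrow> lin (\<lambda>v. S (T v))"
  by (rule linI) (simp_all add: lin_simps)

lemma lin_add: "lin S \<Longrightarrow> lin T \<Longrightarrow> lin (\<lambda>v. S v + T v)"
  by (rule linI) (simp_all add: lin_simps algebra_simps)

lemma lin_diff: "lin S \<Longrightarrow> lin T \<Longrightarrow> lin (\<lambda>v. S v - T v)"
  by (rule linI) (simp_all add: lin_simps algebra_simps)

lemma lin_scale: "lin T \<Longrightarrow> lin (\<lambda>v. c *s T v)"
  by (rule linI) (simp_all add: lin_simps algebra_simps)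

lemma lin_ident: "lin (\<lambda>v. v)"
  by (rule linI) simp_all

lemma lin_sum: "(\<And>i. i \<in> I \<Longrightarrow> lin (S i)) \<Longrightarrow> lin (\<lambda>v. \<Sum>i\<in>I. S i v)"
  by (rule linI) (simp_all add: lin_simps sum.distrib scale_sum_right)

lemma lin_funpow: "lin T \<Longrightarrow> lin (T ^^ n)"
  by (induction n) (auto intro: linI simp: lin_simps)

lemma subspace_image_lin: "lin T \<Longrightarrow> subspace V \<Longrightarrow> subspace (T ` V)"
proof -
  assume "lin T" "subspace V"
  then interpret Vector_Spaces.linear scale scale T by simp
  show ?thesis using \<open>subspace V\<close> by (rule subspace_image)
qed

lemma subspace_kernel_on: "lin T \<Longrightarrow> subspace V \<Longrightarrow> subspace {v \<in> V. T v = 0}"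
  by (rule subspaceI) (auto simp: lin_simps subspace_0 subspace_add subspace_scale)

lemma funpow_closed: "(\<And>v. v \<in> V \<Longrightarrow> T v \<in> V) \<Longrightarrow> v \<in> V \<Longrightarrow> (T ^^ n) v \<in> V"
  by (induction n) auto

lemma lin_eq_on_span: "lin S \<Longrightarrow> lin T \<Longrightarrow> (\<And>x. x \<in> b \<Longrightarrow> S x = T x) \<Longrightarrow> x \<in> span b \<Longrightarrow> S x = T x"
proof -
  assume a: "lin S" "lin T" "\<And>x. x \<in> b \<Longrightarrow> S x = T x" and x: "x \<in> span b"
  have "subspace {x. S x = T x}"
    by (rule subspaceI) (simp_all add: lin_simps a(1,2))
  from span_minimal[OF _ this, of b] a(3) x show "S x = T x" by auto
qed

section \<open>The trace of an operator on an invariant subspace\<close>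

text \<open>The trace is computed in an arbitrary basis of \<open>V\<close>; by \<open>trace_on_eq\<close> below, every basis gives
  the same value for a linear operator that maps \<open>V\<close> into itself.\<close>

definition trace_on :: "'b set \<Rightarrow> ('b \<Rightarrow> 'b) \<Rightarrow> 'a" where
  "trace_on V T =
     (let b = SOME b. independent b \<and> span b = V in \<Sum>v\<in>b. representation b (T v) v)"

lemma subspace_basis:
  assumes "subspace V"
  obtains b where "independent b" "span b = V"
proof -
  obtain b where "b \<subseteq> V" "independent b" "V \<subseteq> span b"
    by (rule maximal_independent_subset)
  with that show thesis using span_subspace[OF _ _ assms] by blast
qed

lemma subspace_basis_extend:
  assumes "subspace V" "independent b" "b \<subseteq> V"
  obtains b' where "b \<subseteq> b'" "independent b'" "span b' = V"
proof -
  obtain b' where "b \<subseteq> b'" "b' \<subseteq> V" "independent b'" "V \<subseteq> span b'"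
    by (rule maximal_independent_subset_extend[OF assms(3,2)])
  with that show thesis using span_subspace[OF _ _ assms(1)] by blast
qed

lemma representation_apply:
  assumes b: "independent b" "x \<in> span b" and T: "lin T" and b': "independent b'"
    "\<And>v. v \<in> b \<Longrightarrow> T v \<in> span b'"
  shows "representation b' (T x) u = (\<Sum>v\<in>b. representation b x v * representation b' (T v) u)"
proof -
  have "x = (\<Sum>v\<in>b. representation b x v *s v)"
    by (rule sum_representation_eq[symmetric]) (use b finiteI_independent in auto)
  then have "T x = (\<Sum>v\<in>b. representation b x v *s T v)"
    by (metis (no_types, lifting) T lin_simps(4,6) sum.cong)
  then show ?thesis
    using b' by (simp add: representation_sum representation_scale span_scale)
qed

lemma trace_on_basis_change:
  assumes "independent b" "span b = V" "independent b'" "span b' = V"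
    and T: "lin T" "\<And>v. v \<in> V \<Longrightarrow> T v \<in> V"
  shows "(\<Sum>v\<in>b. representation b (T v) v) = (\<Sum>u\<in>b'. representation b' (T u) u)"
proof -
  have mem: "v \<in> b \<Longrightarrow> v \<in> V" "u \<in> b' \<Longrightarrow> u \<in> V" for u v
    using assms(2,4) span_base by blast+
  have "(\<Sum>v\<in>b. representation b (T v) v) =
      (\<Sum>v\<in>b. \<Sum>u\<in>b'. representation b' (T v) u * representation b u v)"
    by (intro sum.cong refl representation_apply[where T = "\<lambda>x. x"])
      (use assms mem lin_ident in auto)
  also have "\<dots> = (\<Sum>u\<in>b'. \<Sum>v\<in>b. representation b u v * representation b' (T v) u)"
    by (subst sum.swap) (simp add: mult.commute)
  also have "\<dots> = (\<Sum>u\<in>b'. representation b' (T u) u)"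
    by (intro sum.cong refl representation_apply[symmetric]) (use assms mem in auto)
  finally show ?thesis .
qed

lemma trace_on_eq:
  assumes "independent b" "span b = V" "lin T" "\<And>v. v \<in> V \<Longrightarrow> T v \<in> V"
  shows "trace_on V T = (\<Sum>v\<in>b. representation b (T v) v)"
proof -
  let ?b = "SOME b. independent b \<and> span b = V"
  have "independent ?b \<and> span ?b = V" by (rule someI[of _ b]) (simp add: assms)
  then show ?thesis unfolding trace_on_def Let_def
    by (intro trace_on_basis_change) (use assms in auto)
qed

lemma trace_on_cong:
  assumes "subspace V" "\<And>v. v \<in> V \<Longrightarrow> S v = T v"
  shows "trace_on V S = trace_on V T"
proof -
  let ?b = "SOME b. independent b \<and> span b = V"
  have "independent ?b \<and> span ?b = V"
    by (rule someI_ex) (use subspace_basis[OF assms(1)] in blast)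
  then have "v \<in> ?b \<Longrightarrow> v \<in> V" for v using span_base by blast
  then show ?thesis unfolding trace_on_def Let_def using assms(2) by simp
qed

lemma trace_on_commute:
  assumes V: "subspace V" and S: "lin S" "\<And>v. v \<in> V \<Longrightarrow> S v \<in> V"
    and T: "lin T" "\<And>v. v \<in> V \<Longrightarrow> T v \<in> V"
  shows "trace_on V (\<lambda>v. S (T v)) = trace_on V (\<lambda>v. T (S v))"
proof -
  obtain b where b: "independent b" "span b = V" using subspace_basis[OF V] .
  have mem: "v \<in> b \<Longrightarrow> v \<in> V" for v using b(2) span_base by blast
  have exp: "trace_on V (\<lambda>v. S (T v)) =
      (\<Sum>v\<in>b. \<Sum>u\<in>b. representation b (T v) u * representation b (S u) v)"
    if "lin S" "\<And>v. v \<in> V \<Longrightarrow> S v \<in> V" "lin T" "\<And>v. v \<in> V \<Longrightarrow> T v \<in> V" for S T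
  proof -
    have "trace_on V (\<lambda>v. S (T v)) = (\<Sum>v\<in>b. representation b (S (T v)) v)"
      by (rule trace_on_eq[OF b lin_comp]) (use that in auto)
    also have "\<dots> = (\<Sum>v\<in>b. \<Sum>u\<in>b. representation b (T v) u * representation b (S u) v)"
      by (intro sum.cong refl representation_apply) (use b mem that in auto)
    finally show ?thesis .
  qed
  show ?thesis
    by (simp add: exp S T, subst sum.swap) (simp add: mult.commute)
qed

lemma trace_on_add:
  assumes V: "subspace V" and S: "lin S" "\<And>v. v \<in> V \<Longrightarrow> S v \<in> V"
    and T: "lin T" "\<And>v. v \<in> V \<Longrightarrow> T v \<in> V"
  shows "trace_on V (\<lambda>v. S v + T v) = trace_on V S + trace_on V T"
proof -
  obtain b where b: "independent b" "span b = V" using subspace_basis[OF V] .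
  have mem: "v \<in> b \<Longrightarrow> v \<in> V" for v using b(2) span_base by blast
  have "representation b (S v + T v) v = representation b (S v) v + representation b (T v) v"
    if "v \<in> b" for v
    by (subst representation_add) (use b S T mem that in auto)
  then show ?thesis
    by (simp add: trace_on_eq[OF b] S T lin_add subspace_add[OF V] sum.distrib)
qed

lemma trace_on_scale:
  assumes V: "subspace V" and T: "lin T" "\<And>v. v \<in> V \<Longrightarrow> T v \<in> V"
  shows "trace_on V (\<lambda>v. c *s T v) = c * trace_on V T"
proof -
  obtain b where b: "independent b" "span b = V" using subspace_basis[OF V] .
  have mem: "v \<in> b \<Longrightarrow> v \<in> V" for v using b(2) span_base by blast
  have "representation b (c *s T v) v = c * representation b (T v) v"
    if "v \<in> b" for v
    by (subst representation_scale) (use b T mem that in auto)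
  then show ?thesis
    by (simp add: trace_on_eq[OF b] T lin_scale subspace_scale[OF V] sum_distrib_left)
qed

lemma trace_on_diff:
  assumes V: "subspace V" and S: "lin S" "\<And>v. v \<in> V \<Longrightarrow> S v \<in> V"
    and T: "lin T" "\<And>v. v \<in> V \<Longrightarrow> T v \<in> V"
  shows "trace_on V (\<lambda>v. S v - T v) = trace_on V S - trace_on V T"
proof -
  have "trace_on V (\<lambda>v. S v + (- 1) *s T v) =
      trace_on V S + trace_on V (\<lambda>v. (- 1) *s T v)"
    using assms by (intro trace_on_add lin_scale subspace_scale) auto
  also have "\<dots> = trace_on V S + (- 1) * trace_on V T"
    by (simp only: trace_on_scale[OF V T])
  finally show ?thesis by simp
qed

lemma trace_on_ident:
  assumes V: "subspace V"
  shows "trace_on V (\<lambda>v. v) = of_nat (dim V)"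
proof -
  obtain b where b: "independent b" "span b = V" using subspace_basis[OF V] .
  have "trace_on V (\<lambda>v. v) = (\<Sum>v\<in>b. representation b v v)"
    by (rule trace_on_eq[OF b lin_ident])
  also have "\<dots> = (\<Sum>v\<in>b. 1)"
    by (intro sum.cong refl) (simp add: representation_basis[OF b(1)])
  also have "\<dots> = of_nat (dim V)"
    using b dim_span_eq_card_independent by auto
  finally show ?thesis .
qed

lemma trace_on_zero: "subspace V \<Longrightarrow> trace_on V (\<lambda>v. 0) = 0"
  using trace_on_scale[of V "\<lambda>v. v" 0] by (simp add: lin_ident)

lemma trace_on_sum:
  assumes V: "subspace V" and "finite I"
    and S: "\<And>i. i \<in> I \<Longrightarrow> lin (S i)" "\<And>i v. i \<in> I \<Longrightarrow> v \<in> V \<Longrightarrow> S i v \<in> V"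
  shows "trace_on V (\<lambda>v. \<Sum>i\<in>I. S i v) = (\<Sum>i\<in>I. trace_on V (S i))"
  using \<open>finite I\<close> S
proof (induction I)
  case empty
  then show ?case by (simp add: trace_on_zero[OF V])
next
  case (insert i I)
  have "trace_on V (\<lambda>v. S i v + (\<Sum>i\<in>I. S i v)) =
      trace_on V (S i) + trace_on V (\<lambda>v. \<Sum>i\<in>I. S i v)"
    using insert.prems by (intro trace_on_add V lin_sum subspace_sum) auto
  then show ?case using insert by simp
qed

text \<open>In a basis of \<open>V\<close> that extends one of \<open>U\<close>, the vectors outside \<open>U\<close> contribute nothing to the
  diagonal.\<close>

lemma trace_on_image:
  assumes V: "subspace V" and U: "subspace U" "U \<subseteq> V"
    and T: "lin T" "\<And>v. v \<in> V \<Longrightarrow> T v \<in> U"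
  shows "trace_on V T = trace_on U T"
proof -
  obtain b where b: "independent b" "span b = U" using subspace_basis[OF U(1)] .
  then have "b \<subseteq> V" using U(2) span_base by blast
  obtain b' where b': "b \<subseteq> b'" "independent b'" "span b' = V"
    using subspace_basis_extend[OF V b(1) \<open>b \<subseteq> V\<close>] .
  have mem: "v \<in> b' \<Longrightarrow> v \<in> V" for v using b'(3) span_base by blast
  have rep: "representation b' (T v) v = representation b (T v) v" if "v \<in> b'" for v
    using representation_extend[OF b'(2) _ b'(1), of "T v"] T(2)[OF mem[OF that]] b(2) by simp
  have "trace_on V T = (\<Sum>v\<in>b'. representation b' (T v) v)"
    by (rule trace_on_eq[OF b'(2,3) T(1)]) (use T(2) U(2) in auto)
  also have "\<dots> = (\<Sum>v\<in>b'. representation b (T v) v)"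
    by (simp add: rep)
  also have "\<dots> = (\<Sum>v\<in>b. representation b (T v) v)"
    using b' finiteI_independent[OF b'(2)] representation_ne_zero[of b]
    by (intro sum.mono_neutral_right) auto
  also have "\<dots> = trace_on U T"
    by (rule trace_on_eq[OF b T(1), symmetric]) (use T(2) U(2) in auto)
  finally show ?thesis .
qed

text \<open>Replacing \<open>V\<close> by its image lowers the nilpotency index and keeps the trace.\<close>

lemma trace_on_nilpotent:
  assumes "lin T" "subspace V" "\<And>v. v \<in> V \<Longrightarrow> T v \<in> V" "\<And>v. v \<in> V \<Longrightarrow> (T ^^ n) v = 0"
  shows "trace_on V T = 0"
  using assms
proof (induction n arbitrary: V)
  case 0
  then have "trace_on V T = trace_on V (\<lambda>v. 0)"
    by (intro trace_on_cong) (auto simp: lin_simps)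
  then show ?case using 0 by (simp add: trace_on_zero)
next
  case (Suc n)
  have "trace_on V T = trace_on (T ` V) T"
    using Suc.prems by (intro trace_on_image subspace_image_lin) auto
  also have "\<dots> = 0"
    using Suc.prems by (intro Suc.IH subspace_image_lin) (auto simp: funpow_swap1)
  finally show ?case .
qed

lemma independent_Un:
  assumes A: "independent A" and B: "independent B" and AB: "span A \<inter> span B = {0}"
  shows "independent (A \<union> B)"
proof -
  have "independent (A \<union> C)" if "C \<subseteq> B" for C
    using finite_subset[OF that finiteI_independent[OF B]] that
  proof (induction C)
    case (insert c C)
    have "c \<notin> span (A \<union> C)"
    proof
      assume "c \<in> span (A \<union> C)"
      then obtain x y where xy: "c = x + y" "x \<in> span A" "y \<in> span C"
        unfolding span_Un by blast
      have "y \<in> span B" "c \<in> span B"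
        using xy(3) insert.prems span_mono[of C B] span_base by auto
      then have "x \<in> span B" using xy(1) span_diff[of c B y] by simp
      then have "x = 0" using AB xy(2) by blast
      then have "c \<in> span C" using xy by simp
      moreover have "independent (insert c C)"
        using independent_mono[OF B insert.prems] .
      ultimately show False
        using insert.hyps by (simp add: independent_insert)
    qed
    then show ?case using insert by (simp add: independent_insertI)
  qed (simp add: A)
  then show ?thesis by blast
qed

lemma trace_on_direct_sum:
  assumes V: "subspace V" "V = {x + y | x y. x \<in> U \<and> y \<in> W}"
    and U: "subspace U" and W: "subspace W" and UW: "U \<inter> W = {0}"
    and T: "lin T" "\<And>v. v \<in> U \<Longrightarrow> T v \<in> U" "\<And>v. v \<in> W \<Longrightarrow> T v \<in> W"
  shows "trace_on V T = trace_on U T + trace_on W T"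
proof -
  obtain b where b: "independent b" "span b = U" using subspace_basis[OF U] .
  obtain c where c: "independent c" "span c = W" using subspace_basis[OF W] .
  have bc: "independent (b \<union> c)" "span (b \<union> c) = V"
    using b c UW by (auto simp: independent_Un span_Un V(2))
  have dj: "b \<inter> c = {}"
  proof -
    have "b \<inter> c \<subseteq> {0}" using UW b(2) c(2) span_base by blast
    moreover have "0 \<notin> b" using b(1) dependent_zero by blast
    ultimately show ?thesis by blast
  qed
  have mem: "v \<in> b \<Longrightarrow> T v \<in> span b" "v \<in> c \<Longrightarrow> T v \<in> span c" for v
    using b(2) c(2) T span_base by blast+
  have "trace_on V T = (\<Sum>v\<in>b \<union> c. representation (b \<union> c) (T v) v)"
  proof (rule trace_on_eq[OF bc T(1)])
    fix v assume "v \<in> V"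
    then obtain x y where "v = x + y" "x \<in> U" "y \<in> W" unfolding V(2) by blast
    then have "T v = T x + T y" "T x \<in> U" "T y \<in> W" by (simp_all add: T lin_simps)
    then show "T v \<in> V" unfolding V(2) by blast
  qed
  also have "\<dots> = (\<Sum>v\<in>b. representation (b \<union> c) (T v) v) + (\<Sum>v\<in>c. representation (b \<union> c) (T v) v)"
    using b c dj finiteI_independent by (intro sum.union_disjoint) auto
  also have "(\<Sum>v\<in>b. representation (b \<union> c) (T v) v) = (\<Sum>v\<in>b. representation b (T v) v)"
    by (intro sum.cong refl) (simp add: representation_extend[OF bc(1) mem(1)])
  also have "(\<Sum>v\<in>c. representation (b \<union> c) (T v) v) = (\<Sum>v\<in>c. representation c (T v) v)"
    by (intro sum.cong refl) (simp add: representation_extend[OF bc(1) mem(2)])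
  finally show ?thesis
    using trace_on_eq[OF b T(1,2)] trace_on_eq[OF c T(1,3)] by simp
qed

section \<open>Fitting decomposition and generalised eigenspaces\<close>

text \<open>For \<open>N\<close> large the kernels of the powers on \<open>V\<close> have stopped growing.  Then \<open>T ^^ N\<close> is injective on
  its image in \<open>V\<close>, hence bijective there, and each vector of \<open>V\<close> differs from an element of that
  image by an element of the kernel.\<close>

lemma fitting_decomposition:
  assumes T: "lin T" "\<And>v. v \<in> V \<Longrightarrow> T v \<in> V" and V: "subspace V"
  shows "\<exists>N>0. (\<forall>k. \<forall>v\<in>V. (T ^^ k) v = 0 \<longrightarrow> (T ^^ N) v = 0) \<and>
    {v \<in> V. (T ^^ N) v = 0} \<inter> (T ^^ N) ` V = {0} \<and>
    V = {x + y | x y. x \<in> {v \<in> V. (T ^^ N) v = 0} \<and> y \<in> (T ^^ N) ` V}"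
proof -
  define K where "K n = {v \<in> V. (T ^^ n) v = 0}" for n
  note linT = lin_funpow[OF T(1)]
  have sK: "subspace (K n)" for n
    unfolding K_def by (rule subspace_kernel_on[OF linT V])
  have mono: "K m \<subseteq> K n" if "m \<le> n" for m n
  proof
    fix v assume "v \<in> K m"
    moreover have "(T ^^ n) v = (T ^^ (n - m)) ((T ^^ m) v)"
      using that by (metis comp_apply funpow_add le_add_diff_inverse2)
    ultimately show "v \<in> K n" using lin_simps(5)[OF linT] by (simp add: K_def)
  qed
  have "\<exists>N. True \<and> (\<forall>n. True \<longrightarrow> dim (K n) \<le> dim (K N))"
    by (rule ex_has_greatest_nat[where b = "Suc dimension" and k = 0])
      (simp_all add: dim_subset_UNIV less_Suc_eq_le)
  then obtain N0 where N0: "\<And>n. dim (K n) \<le> dim (K N0)" by blast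
  \<comment> \<open>The successor only serves to make the exponent positive.\<close>
  define N where "N = Suc N0"
  have KN: "K n \<subseteq> K N" for n
  proof -
    have "K N0 = K (max N n)"
      by (rule subspace_dim_equal[OF sK sK mono N0]) (simp add: N_def)
    then show ?thesis using mono[of n "max N n"] mono[of N0 N] by (simp add: N_def)
  qed
  let ?I = "(T ^^ N) ` V"
  have TN: "(T ^^ N) v \<in> V" if "v \<in> V" for v
    by (rule funpow_closed[OF T(2) that])
  have sI: "subspace ?I" by (rule subspace_image_lin[OF linT V])
  have inj0: "v = 0" if v: "v \<in> ?I" "(T ^^ N) v = 0" for v
  proof -
    obtain w where w: "w \<in> V" "v = (T ^^ N) w" using v(1) by blast
    then have "w \<in> K (N + N)" using v(2) by (simp add: K_def funpow_add)
    then show ?thesis using KN w by (auto simp: K_def)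
  qed
  interpret p: finite_dimensional_vector_space_pair_1 scale Basis scale ..
  have "inj_on (T ^^ N) ?I"
  proof (rule inj_onI)
    fix x y assume "x \<in> ?I" "y \<in> ?I" "(T ^^ N) x = (T ^^ N) y"
    then have "x - y = 0"
      using inj0[of "x - y"] subspace_diff[OF sI] by (simp add: lin_simps(2)[OF linT])
    then show "x = y" by simp
  qed
  moreover have "span ?I = ?I" using sI by (simp only: span_eq_iff)
  ultimately have "inj_on (T ^^ N) (span ?I)" by (simp only:)
  then have "dim ((T ^^ N) ` ?I) = dim ?I"
    using p.dim_image_eq[OF linT] by blast
  then have surj: "(T ^^ N) ` ?I = ?I"
    by (intro subspace_dim_equal subspace_image_lin linT sI) (use TN in auto)
  show ?thesis
  proof (intro exI[of _ N] conjI allI ballI impI)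
    show "N > 0" by (simp add: N_def)
    show "(T ^^ N) v = 0" if "v \<in> V" "(T ^^ k) v = 0" for k v
      using KN[of k] that by (auto simp: K_def)
    show "{v \<in> V. (T ^^ N) v = 0} \<inter> ?I = {0}"
      using inj0 subspace_0[OF sI] subspace_0[OF V] lin_simps(5)[OF linT] by auto
    show "V = {x + y | x y. x \<in> {v \<in> V. (T ^^ N) v = 0} \<and> y \<in> ?I}"
    proof (intro equalityI subsetI)
      fix v assume v: "v \<in> V"
      then have "(T ^^ N) v \<in> (T ^^ N) ` ?I" unfolding surj by blast
      then obtain w where w: "w \<in> ?I" "(T ^^ N) v = (T ^^ N) w" by blast
      have "v - w \<in> {v \<in> V. (T ^^ N) v = 0}"
        using w v TN by (auto simp: lin_simps[OF linT] intro: subspace_diff[OF V])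
      then show "v \<in> {x + y | x y. x \<in> {v \<in> V. (T ^^ N) v = 0} \<and> y \<in> ?I}"
        using w(1) by (metis (mono_tags, lifting) diff_add_cancel mem_Collect_eq)
    next
      fix v assume "v \<in> {x + y | x y. x \<in> {v \<in> V. (T ^^ N) v = 0} \<and> y \<in> ?I}"
      then show "v \<in> V" using TN by (auto intro: subspace_add[OF V])
    qed
  qed
qed

text \<open>This is \<open>p(T) v\<close>, evaluated by the Horner scheme.\<close>

definition poly_apply :: "'a poly \<Rightarrow> ('b \<Rightarrow> 'b) \<Rightarrow> 'b \<Rightarrow> 'b" where
  "poly_apply p T v = fold_coeffs (\<lambda>a w. a *s v + T w) p 0"

lemma poly_apply_0: "poly_apply 0 T v = 0"
  by (simp add: poly_apply_def)

lemma poly_apply_pCons: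
  "lin T \<Longrightarrow> poly_apply (pCons a p) T v = a *s v + T (poly_apply p T v)"
  by (cases "p = 0 \<and> a = 0") (auto simp: poly_apply_def lin_simps)

lemma poly_apply_add:
  "lin T \<Longrightarrow> poly_apply (p + q) T v = poly_apply p T v + poly_apply q T v"
proof (induction p arbitrary: q)
  case 0
  then show ?case by (simp add: poly_apply_0)
next
  case (pCons a p)
  show ?case
    by (cases q) (simp add: pCons poly_apply_pCons lin_simps scale_left_distrib)
qed

lemma poly_apply_smult: "lin T \<Longrightarrow> poly_apply (smult c p) T v = c *s poly_apply p T v"
  by (induction p) (simp_all add: poly_apply_0 poly_apply_pCons lin_simps scale_right_distrib)

lemma poly_apply_monom: "lin T \<Longrightarrow> poly_apply (monom 1 n) T v = (T ^^ n) v"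
  by (induction n) (simp_all add: monom_Suc monom_0 poly_apply_pCons poly_apply_0 lin_simps one_pCons)

lemma poly_apply_linear_factor:
  assumes "lin T"
  shows "poly_apply ([:- a, 1:] * q) T v = T (poly_apply q T v) - a *s poly_apply q T v"
proof -
  have "[:- a, 1:] * q = pCons 0 q + smult (- a) q" by simp
  then show ?thesis
    using assms by (simp only: poly_apply_add poly_apply_pCons poly_apply_smult) simp
qed

lemma poly_apply_closed:
  assumes "lin T" "subspace V" "\<And>v. v \<in> V \<Longrightarrow> T v \<in> V" "v \<in> V"
  shows "poly_apply p T v \<in> V"
  by (induction p) (use assms in \<open>auto simp: poly_apply_0 poly_apply_pCons subspace_0 subspace_add subspace_scale\<close>)

text \<open>The first iterate \<open>(T ^^ n) v\<close> that depends linearly on its predecessors gives a monic relation;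
  there is one because an independent set has at most \<open>dimension\<close> elements.\<close>

lemma annihilating_polynomial:
  assumes T: "lin T"
  obtains p where "p \<noteq> 0" "poly_apply p T v = 0"
proof -
  define S where "S n = (\<lambda>i. (T ^^ i) v) ` {..<n}" for n
  have "\<exists>n. (T ^^ n) v \<in> span (S n)"
  proof (rule ccontr)
    assume neg: "\<nexists>n. (T ^^ n) v \<in> span (S n)"
    have "independent (S n) \<and> card (S n) = n" for n
    proof (induction n)
      case (Suc n)
      have eq: "S (Suc n) = insert ((T ^^ n) v) (S n)"
        by (simp add: S_def lessThan_Suc)
      have "(T ^^ n) v \<notin> S n" using neg span_base by blast
      then show ?case
        using Suc neg unfolding eq by (simp add: independent_insertI S_def)
    qed (simp add: S_def independent_empty)
    from this[of "Suc dimension"] show False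
      using independent_card_le_dim[of "S (Suc dimension)" UNIV]
      by (simp add: dimension_def)
  qed
  then obtain n where n: "(T ^^ n) v \<in> span (S n)" ..
  have "subspace {w. \<exists>p. (\<forall>i\<ge>n. coeff p i = 0) \<and> poly_apply p T v = w}" (is "subspace ?P")
  proof (rule subspaceI)
    show "0 \<in> ?P" using poly_apply_0 by (auto intro!: exI[of _ 0])
  next
    fix x y assume "x \<in> ?P" "y \<in> ?P"
    then obtain p q where "\<forall>i\<ge>n. coeff p i = 0" "poly_apply p T v = x"
      "\<forall>i\<ge>n. coeff q i = 0" "poly_apply q T v = y" by blast
    then show "x + y \<in> ?P" by (auto intro!: exI[of _ "p + q"] simp: poly_apply_add[OF T])
  next
    fix c x assume "x \<in> ?P"
    then obtain p where "\<forall>i\<ge>n. coeff p i = 0" "poly_apply p T v = x" by blast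
    then show "c *s x \<in> ?P" by (auto intro!: exI[of _ "smult c p"] simp: poly_apply_smult[OF T])
  qed
  moreover have "S n \<subseteq> ?P"
  proof
    fix w assume "w \<in> S n"
    then obtain i where "i < n" "w = (T ^^ i) v" by (auto simp: S_def)
    then show "w \<in> ?P" by (auto intro!: exI[of _ "monom 1 i"] simp: poly_apply_monom[OF T])
  qed
  ultimately have "(T ^^ n) v \<in> ?P" using n span_minimal by blast
  then obtain p where p: "\<forall>i\<ge>n. coeff p i = 0" "poly_apply p T v = (T ^^ n) v" by blast
  define q where "q = monom 1 n + smult (- 1) p"
  have "coeff q n = 1" using p(1) by (simp add: q_def)
  then have "q \<noteq> 0" by auto
  moreover have "poly_apply q T v = 0"
    unfolding q_def poly_apply_add[OF T] poly_apply_smult[OF T] poly_apply_monom[OF T] p(2) by simp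
  ultimately show thesis by (rule that)
qed

lemma lin_shift: "lin T \<Longrightarrow> lin (\<lambda>v. T v - a *s v)"
  by (rule linI) (simp_all add: lin_simps algebra_simps)

lemma gen_eigen_closed:
  assumes "lin T" "subspace V" "\<And>v. v \<in> V \<Longrightarrow> T v \<in> V" "v \<in> V"
  shows "T v - a *s v \<in> V"
  using assms by (simp add: subspace_diff subspace_scale)

lemma funpow_commute:
  assumes "\<And>w. A (B w) = B (A w)"
  shows "(A ^^ i) (B v) = B ((A ^^ i) v)"
  by (induction i) (simp_all add: assms)

text \<open>By induction both \<open>T v - a v\<close> and \<open>T v - b v\<close> vanish, since each of them satisfies the same two
  conditions with one exponent lowered; subtract.\<close>

lemma gen_eigenvectors_distinct:
  assumes T: "lin T" and "a \<noteq> b"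
    and "((\<lambda>v. T v - a *s v) ^^ m) v = 0" "((\<lambda>v. T v - b *s v) ^^ n) v = 0"
  shows "v = 0"
  using assms(3,4)
proof (induction "m + n" arbitrary: m n v)
  case 0
  then show ?case by simp
next
  case (Suc k)
  let ?A = "\<lambda>v. T v - a *s v" and ?B = "\<lambda>v. T v - b *s v"
  note lA = lin_shift[OF T, of a] and lB = lin_shift[OF T, of b]
  have comm: "(?A ^^ i) (?B v) = ?B ((?A ^^ i) v)" "(?B ^^ i) (?A v) = ?A ((?B ^^ i) v)" for i v
    by (rule funpow_commute, simp add: lin_simps[OF T] algebra_simps)+
  show ?case
  proof (cases "m = 0 \<or> n = 0")
    case True
    then show ?thesis using Suc.prems by auto
  next
    case False
    then obtain m' n' where mn: "m = Suc m'" "n = Suc n'" by (metis not0_implies_Suc)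
    have "?A v = 0"
    proof (rule Suc.hyps(1)[of m' n])
      show "(?A ^^ m') (?A v) = 0" using Suc.prems(1) unfolding mn(1) funpow_Suc_right by simp
      show "(?B ^^ n) (?A v) = 0" using Suc.prems(2) by (simp add: comm(2) lin_simps(5)[OF T])
    qed (use Suc.hyps(2) mn in simp)
    moreover have "?B v = 0"
    proof (rule Suc.hyps(1)[of m n'])
      show "(?B ^^ n') (?B v) = 0" using Suc.prems(2) unfolding mn(2) funpow_Suc_right by simp
      show "(?A ^^ m) (?B v) = 0" using Suc.prems(1) by (simp add: comm(1) lin_simps(5)[OF T])
    qed (use Suc.hyps(2) mn in simp)
    ultimately have "(a - b) *s v = 0" by (simp add: scale_left_diff_distrib)
    then show ?thesis using \<open>a \<noteq> b\<close> by simp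
  qed
qed

end

locale closed_field_space= finite_dimensional_vector_space scale Basis
  for scale :: "'k::{alg_closed_field, field_char_0} \<Rightarrow> 'b::ab_group_add \<Rightarrow> 'b"  (infixr \<open>*s\<close> 75)
    and Basis
begin

text \<open>Split linear factors \<open>X - a\<close> off a polynomial that annihilates a nonzero \<open>v\<close>.  The first time that
  the cofactor \<open>q\<close> does not annihilate \<open>v\<close>, the vector \<open>q(T) v\<close> is an eigenvector for \<open>a\<close>.\<close>

lemma eigenvector_exists:
  assumes T: "lin T" "\<And>v. v \<in> V \<Longrightarrow> T v \<in> V" and V: "subspace V" "V \<noteq> {0}"
  obtains a v where "v \<in> V" "v \<noteq> 0" "T v = a *s v"
proof -
  obtain v where v: "v \<in> V" "v \<noteq> 0" using V subspace_0 by blast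
  obtain p where "p \<noteq> 0" "poly_apply p T v = 0" by (rule annihilating_polynomial[OF T(1)])
  then have "\<exists>a w. w \<in> V \<and> w \<noteq> 0 \<and> T w = a *s w"
  proof (induction "degree p" arbitrary: p rule: less_induct)
    case less
    show ?case
    proof (cases "degree p = 0")
      case True
      then obtain c where "p = [:c:]" by (rule degree_eq_zeroE)
      then show ?thesis
        using less.prems v(2) by (simp add: poly_apply_pCons poly_apply_0 T(1) lin_simps)
    next
      case False
      then obtain a where "poly p a = 0" using alg_closed_imp_poly_has_root by blast
      then obtain q where q: "p = [:- a, 1:] * q" using poly_eq_0_iff_dvd by (metis dvdE)
      then have "q \<noteq> 0" "degree q < degree p" using less.prems(1) by (auto simp: degree_mult_eq simp del: mult_pCons_left)
      show ?thesis
      proof (cases "poly_apply q T v = 0")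
        case True
        then show ?thesis using less.hyps \<open>q \<noteq> 0\<close> \<open>degree q < degree p\<close> by blast
      next
        case False
        moreover have "T (poly_apply q T v) = a *s poly_apply q T v"
          using less.prems(2) unfolding q poly_apply_linear_factor[OF T(1)] by simp
        ultimately show ?thesis using poly_apply_closed[OF T(1) V(1) T(2) v(1)] by blast
      qed
    qed
  qed
  with that show thesis by blast
qed

text \<open>Induction along the decomposition of \<open>V\<close> into generalised eigenspaces: the Fitting decomposition
  of \<open>T - a\<close>, for an eigenvalue \<open>a\<close>, splits off a nonzero summand \<open>U\<close> on which \<open>T - a\<close> is nilpotent.\<close>

lemma spectral_induct [consumes 3, case_names zero sum]:
  assumes T: "lin T" and V: "subspace V" and TV: "T ` V \<subseteq> V"
    and zero: "P {0}"
    and sum: "\<And>V U W a N. subspace V \<Longrightarrow> subspace U \<Longrightarrow> subspace W \<Longrightarrow>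
      V = {x + y | x y. x \<in> U \<and> y \<in> W} \<Longrightarrow> U \<inter> W = {0} \<Longrightarrow>
      (\<And>v. v \<in> U \<Longrightarrow> T v \<in> U) \<Longrightarrow> (\<And>v. v \<in> W \<Longrightarrow> T v \<in> W) \<Longrightarrow>
      (\<And>v. v \<in> U \<Longrightarrow> ((\<lambda>v. T v - a *s v) ^^ N) v = 0) \<Longrightarrow> U \<noteq> {0} \<Longrightarrow> P W \<Longrightarrow> P V"
  shows "P V"
  using V TV
proof (induction "dim V" arbitrary: V rule: less_induct)
  case less
  have TV: "\<And>v. v \<in> V \<Longrightarrow> T v \<in> V" using less.prems(2) by blast
  show ?case
  proof (cases "V = {0}")
    case True
    then show ?thesis using zero by simp
  next
    case False
    obtain a v where v: "v \<in> V" "v \<noteq> 0" "T v = a *s v"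
      by (rule eigenvector_exists[OF T TV less.prems(1) False])
    let ?A = "\<lambda>v. T v - a *s v"
    note lA = lin_shift[OF T, of a]
    have AV: "?A v \<in> V" if "v \<in> V" for v
      by (rule gen_eigen_closed[OF T less.prems(1) TV that])
    have "\<exists>N>0. (\<forall>k. \<forall>v\<in>V. (?A ^^ k) v = 0 \<longrightarrow> (?A ^^ N) v = 0) \<and>
        {v \<in> V. (?A ^^ N) v = 0} \<inter> (?A ^^ N) ` V = {0} \<and>
        V = {x + y | x y. x \<in> {v \<in> V. (?A ^^ N) v = 0} \<and> y \<in> (?A ^^ N) ` V}"
      by (rule fitting_decomposition[OF lA _ less.prems(1)]) (rule AV)
    then obtain N where N: "\<And>k v. v \<in> V \<Longrightarrow> (?A ^^ k) v = 0 \<Longrightarrow> (?A ^^ N) v = 0"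
      and int: "{v \<in> V. (?A ^^ N) v = 0} \<inter> (?A ^^ N) ` V = {0}"
      and add: "V = {x + y | x y. x \<in> {v \<in> V. (?A ^^ N) v = 0} \<and> y \<in> (?A ^^ N) ` V}"
      by blast
    let ?U = "{v \<in> V. (?A ^^ N) v = 0}" and ?W = "(?A ^^ N) ` V"
    have comm: "(?A ^^ i) (T v) = T ((?A ^^ i) v)" for i v
      by (rule funpow_commute) (simp add: lin_simps[OF T])
    have sU: "subspace ?U" by (rule subspace_kernel_on[OF lin_funpow[OF lA] less.prems(1)])
    have sW: "subspace ?W" by (rule subspace_image_lin[OF lin_funpow[OF lA] less.prems(1)])
    have vU: "v \<in> ?U" using v N[of v 1] by simp
    have TU: "T u \<in> ?U" if "u \<in> ?U" for u
      using that TV by (simp add: comm lin_simps[OF T])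
    have TW: "T u \<in> ?W" if "u \<in> ?W" for u
      using that TV by (auto simp: comm[symmetric])
    have "?W \<subseteq> V" using funpow_closed[of V ?A, OF AV] by blast
    moreover have "v \<notin> ?W" using vU int v(2) by blast
    ultimately have "?W \<subset> V" using v(1) by blast
    then have "dim ?W < dim V"
      by (metis dim_psubset less.prems(1) sW span_eq_iff)
    moreover have "T ` ?W \<subseteq> ?W" using TW by blast
    ultimately have "P ?W" by (intro less.hyps sW)
    moreover have "?U \<noteq> {0}" using vU v(2) by blast
    ultimately show ?thesis
      by (intro sum[OF less.prems(1) sU sW add int TU TW, where a = a and N = N]) simp_all
  qed
qed

end

section \<open>An operator conjugate to a given one\<close>

text \<open>The field is a vector space over the rationals, and a nonzero element extends to a basis of it.\<close>

lemma rational_functional_exists: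
  fixes a :: "'k::field_char_0"
  assumes "a \<noteq> 0"
  obtains f :: "'k \<Rightarrow> rat" where "\<And>x y. f (x + y) = f x + f y" "\<And>q x. f (of_rat q * x) = q * f x" "f a \<noteq> 0"
proof -
  interpret K: vector_space "\<lambda>q (x::'k). of_rat q * x"
    by unfold_locales (simp_all add: algebra_simps of_rat_add of_rat_mult)
  interpret Q: vector_space "(*) :: rat \<Rightarrow> rat \<Rightarrow> rat"
    by unfold_locales (simp_all add: algebra_simps)
  interpret KQ: vector_space_pair "\<lambda>q (x::'k). of_rat q * x" "(*) :: rat \<Rightarrow> rat \<Rightarrow> rat" ..
  have "K.independent {a}" using assms by simp
  then obtain f where f: "Vector_Spaces.linear (\<lambda>q (x::'k). of_rat q * x) (*) f" "f a = 1"
    using KQ.linear_independent_extend[of "{a}" "\<lambda>_. 1"] by auto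
  interpret f: Vector_Spaces.linear "\<lambda>q (x::'k). of_rat q * x" "(*)" f by (rule f(1))
  show thesis by (rule that[of f]) (simp_all add: f.add f.scale f(2))
qed

context closed_field_space
begin

text \<open>The two components of a vector are mapped independently, so one vanishes when the sum does.\<close>

lemma direct_sum_kernel:
  assumes "lin A" "\<And>v. v \<in> U \<Longrightarrow> A v \<in> U" "\<And>v. v \<in> W \<Longrightarrow> A v \<in> W" "subspace U" "U \<inter> W = {0}"
    and "x \<in> U" "y \<in> W" "(A ^^ n) (x + y) = 0"
  shows "(A ^^ n) x = 0" "(A ^^ n) y = 0"
proof -
  have "(A ^^ n) x \<in> U" "(A ^^ n) y \<in> W"
    using assms by (auto intro: funpow_closed)
  moreover have "(A ^^ n) x + (A ^^ n) y = 0"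
    using assms(8) by (simp add: lin_simps(1)[OF lin_funpow[OF assms(1)]])
  then have e: "(A ^^ n) y = - (A ^^ n) x" by (simp add: add_eq_0_iff)
  ultimately have "(A ^^ n) y \<in> U \<inter> W" using subspace_neg[OF assms(4)] by auto
  then show "(A ^^ n) y = 0" using assms(5) by blast
  then show "(A ^^ n) x = 0" using e by simp
qed

lemma gen_eigenvectors_span:
  assumes T: "lin T" and V: "subspace V" and TV: "\<And>v. v \<in> V \<Longrightarrow> T v \<in> V"
  shows "V \<subseteq> span {v \<in> V. \<exists>a n. ((\<lambda>v. T v - a *s v) ^^ n) v = 0}"
proof -
  have "T ` V \<subseteq> V" using TV by blast
  with T V show ?thesis
  proof (induction rule: spectral_induct)
    case zero
    show ?case using span_zero by auto
  next
    case (sum V U W a N)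
    let ?G = "\<lambda>V. {v \<in> V. \<exists>a n. ((\<lambda>v. T v - a *s v) ^^ n) v = 0}"
    have UV: "U \<subseteq> V" "W \<subseteq> V"
      using subspace_0[OF sum(2)] subspace_0[OF sum(3)] unfolding sum(4) by force+
    then have "span (?G W) \<subseteq> span (?G V)" by (intro span_mono) auto
    then have "W \<subseteq> span (?G V)" using sum by blast
    moreover have "U \<subseteq> ?G V" using UV sum(8) by blast
    then have "U \<subseteq> span (?G V)" using span_superset by blast
    ultimately have "x + y \<in> span (?G V)" if "x \<in> U" "y \<in> W" for x y
      using that by (intro span_add) auto
    then show ?case by (subst sum(4)) auto
  qed
qed

text \<open>The operator \<open>Y\<close> is the scalar \<open>f a\<close> on each generalised eigenspace \<open>V\<^sub>a\<close>, so
  \<open>tr (T Y) = \<Sum> dim V\<^sub>a * a * f a\<close>.  Applying the rational-linear \<open>f\<close> once more turns this into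
  \<open>\<Sum> dim V\<^sub>a * (f a)\<^sup>2\<close>, which is nonnegative and vanishes only if \<open>f\<close> kills every eigenvalue.  Over
  the complex numbers, complex conjugation can play the part of \<open>f\<close>; a functional with rational values
  does the same for every field of characteristic zero.\<close>

lemma conjugate_operator_exists:
  fixes f :: "'k \<Rightarrow> rat"
  assumes f: "\<And>x y. f (x + y) = f x + f y" "\<And>q x. f (of_rat q * x) = q * f x"
    and T: "lin T" and V: "subspace V" and TV: "\<And>v. v \<in> V \<Longrightarrow> T v \<in> V"
  shows "\<exists>Y. lin Y \<and> (\<forall>v\<in>V. Y v \<in> V) \<and>
    (\<forall>a n. \<forall>v\<in>V. ((\<lambda>v. T v - a *s v) ^^ n) v = 0 \<longrightarrow> Y v = of_rat (f a) *s v) \<and>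
    f (trace_on V (\<lambda>v. T (Y v))) \<ge> 0 \<and>
    (f (trace_on V (\<lambda>v. T (Y v))) = 0 \<longrightarrow>
       (\<forall>a. \<forall>v\<in>V. v \<noteq> 0 \<longrightarrow> T v = a *s v \<longrightarrow> f a = 0))"
proof -
  have "T ` V \<subseteq> V" using TV by blast
  with T V show ?thesis
  proof (induction rule: spectral_induct)
    case zero
    have "f 0 = 0" using f(1)[of 0 0] by simp
    moreover have "trace_on {0} T = 0"
      using trace_on_cong[of "{0}" T "\<lambda>v. 0"] by (simp add: lin_simps(5)[OF T] trace_on_zero)
    ultimately show ?case by (intro exI[of _ "\<lambda>v. v"]) (simp add: lin_ident)
  next
    case (sum V U W a N)
    note V = sum(1) and U = sum(2) and W = sum(3) and V_eq = sum(4) and UW = sum(5)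
      and TU = sum(6) and TW = sum(7) and nil = sum(8)
    obtain Y' where Y': "lin Y'" "\<And>v. v \<in> W \<Longrightarrow> Y' v \<in> W"
      "\<And>a n v. v \<in> W \<Longrightarrow> ((\<lambda>v. T v - a *s v) ^^ n) v = 0 \<Longrightarrow> Y' v = of_rat (f a) *s v"
      "f (trace_on W (\<lambda>v. T (Y' v))) \<ge> 0"
      "\<And>a v. f (trace_on W (\<lambda>v. T (Y' v))) = 0 \<Longrightarrow> v \<in> W \<Longrightarrow> v \<noteq> 0 \<Longrightarrow> T v = a *s v \<Longrightarrow> f a = 0"
      using sum(10) by blast
    obtain b where b: "independent b" "span b = U" using subspace_basis[OF U] .
    obtain c where c: "independent c" "span c = W" using subspace_basis[OF W] .
    have bc: "independent (b \<union> c)" using b c UW independent_Un by auto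
    interpret p: vector_space_pair scale scale ..
    have dj: "x \<notin> b" if "x \<in> c" for x
    proof
      assume "x \<in> b"
      then have "x = 0" using that b(2) c(2) span_base UW by blast
      then show False using \<open>x \<in> b\<close> b(1) dependent_zero by blast
    qed
    obtain Y where Y: "lin Y" "\<And>x. x \<in> b \<Longrightarrow> Y x = of_rat (f a) *s x" "\<And>x. x \<in> c \<Longrightarrow> Y x = Y' x"
      using p.linear_independent_extend[OF bc, of "\<lambda>x. if x \<in> b then of_rat (f a) *s x else Y' x"] dj
      by auto
    have YU: "Y x = of_rat (f a) *s x" if "x \<in> U" for x
      using lin_eq_on_span[OF Y(1) lin_scale[OF lin_ident] Y(2), of b x] that b(2) by blast
    have YW: "Y x = Y' x" if "x \<in> W" for x
      using lin_eq_on_span[OF Y(1) Y'(1) Y(3), of c x] that c(2) by blast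
    have shiftU: "T v - e *s v \<in> U" if "v \<in> U" for v e
      using gen_eigen_closed[OF T U _ that] TU by blast
    have shiftW: "T v - e *s v \<in> W" if "v \<in> W" for v e
      using gen_eigen_closed[OF T W _ that] TW by blast
    have UV: "U \<subseteq> V" "W \<subseteq> V"
      using subspace_0[OF U] subspace_0[OF W] unfolding V_eq by force+
    have YV: "Y v \<in> V" if "v \<in> V" for v
    proof -
      obtain x y where xy: "v = x + y" "x \<in> U" "y \<in> W" using \<open>v \<in> V\<close> unfolding V_eq by blast
      then have "Y v = of_rat (f a) *s x + Y' y" by (simp add: lin_simps[OF Y(1)] YU YW)
      then show ?thesis using xy UV Y'(2) by (auto intro!: subspace_add[OF V] subspace_scale[OF V])
    qed
    have comp: "((\<lambda>v. T v - e *s v) ^^ n) x = 0 \<and> ((\<lambda>v. T v - e *s v) ^^ n) y = 0 \<and> (x = 0 \<or> e = a)"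
      if "x \<in> U" "y \<in> W" "((\<lambda>v. T v - e *s v) ^^ n) (x + y) = 0" for x y e n
    proof -
      note d = direct_sum_kernel[where A = "\<lambda>v. T v - e *s v", OF lin_shift[OF T] shiftU shiftW U UW that]
      show ?thesis using d gen_eigenvectors_distinct[OF T, of e a n x N] nil[OF that(1)] by blast
    qed
    have gen: "Y v = of_rat (f e) *s v" if v: "v \<in> V" "((\<lambda>v. T v - e *s v) ^^ n) v = 0" for e n v
    proof -
      obtain x y where xy: "v = x + y" "x \<in> U" "y \<in> W" using \<open>v \<in> V\<close> unfolding V_eq by blast
      note d = comp[OF xy(2,3) v(2)[unfolded xy(1)]]
      have "Y x = of_rat (f e) *s x" using d YU[OF xy(2)] by auto
      moreover have "Y y = of_rat (f e) *s y" using d Y'(3)[OF xy(3)] YW[OF xy(3)] by auto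
      ultimately show ?thesis by (simp add: xy(1) lin_simps[OF Y(1)] scale_right_distrib)
    qed
    have trU: "trace_on U T = of_nat (dim U) * a"
    proof -
      have "trace_on U (\<lambda>v. T v - a *s v) = 0"
        by (rule trace_on_nilpotent[OF lin_shift[OF T] U shiftU nil])
      moreover have "trace_on U (\<lambda>v. T v - a *s v) = trace_on U T - trace_on U (\<lambda>v. a *s v)"
        by (rule trace_on_diff[OF U T _ lin_scale[OF lin_ident]]) (use TU subspace_scale[OF U] in auto)
      moreover have "trace_on U (\<lambda>v. a *s v) = a * of_nat (dim U)"
        using trace_on_scale[OF U lin_ident, of a] by (simp add: trace_on_ident[OF U])
      ultimately show ?thesis by (simp add: mult.commute)
    qed
    have "trace_on V (\<lambda>v. T (Y v)) = trace_on U (\<lambda>v. T (Y v)) + trace_on W (\<lambda>v. T (Y v))"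
      by (rule trace_on_direct_sum[OF V V_eq U W UW lin_comp[OF T Y(1)]])
        (use YU YW TU TW Y'(2) subspace_scale[OF U] in auto)
    also have "trace_on U (\<lambda>v. T (Y v)) = trace_on U (\<lambda>v. of_rat (f a) *s T v)"
      by (rule trace_on_cong[OF U]) (simp add: YU lin_simps[OF T])
    also have "\<dots> = of_rat (f a * of_nat (dim U)) * a"
      using trace_on_scale[OF U T TU] by (simp add: trU of_rat_mult)
    also have "trace_on W (\<lambda>v. T (Y v)) = trace_on W (\<lambda>v. T (Y' v))"
      by (rule trace_on_cong[OF W]) (simp add: YW)
    finally have tr: "f (trace_on V (\<lambda>v. T (Y v))) = f a * f a * of_nat (dim U) + f (trace_on W (\<lambda>v. T (Y' v)))"
      by (simp only: f) (simp only: mult_ac)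
    have ev: "f e = 0" if "f (trace_on V (\<lambda>v. T (Y v))) = 0" "v \<in> V" "v \<noteq> 0" "T v = e *s v" for e v
    proof -
      have z: "f a * f a * of_nat (dim U) = 0" "f (trace_on W (\<lambda>v. T (Y' v))) = 0"
        using that(1) Y'(4) unfolding tr by (simp_all add: add_nonneg_eq_0_iff)
      obtain x y where xy: "v = x + y" "x \<in> U" "y \<in> W" using \<open>v \<in> V\<close> unfolding V_eq by blast
      have "((\<lambda>v. T v - e *s v) ^^ 1) (x + y) = 0" using that(4) xy by simp
      from comp[OF xy(2,3) this] have d: "T y = e *s y" "x = 0 \<or> e = a" by auto
      show ?thesis
      proof (cases "x = 0")
        case True
        then show ?thesis using z(2) d xy that(3) Y'(5)[of y e] by simp
      next
        case False
        then show ?thesis using d z(1) xy(2) by auto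
      qed
    qed
    show ?case
      by (intro exI[of _ Y] conjI allI ballI impI; (rule ev gen YV Y(1))?)
        (simp_all add: tr Y'(4))
  qed
qed

section \<open>Orthonormal sets\<close>

text \<open>An orthonormal set in \<open>W\<close> of maximal cardinality splits \<open>W\<close> into its span and its orthogonal
  complement.  By maximality no vector \<open>x\<close> of the complement has \<open>B x x \<noteq> 0\<close>, since it could be scaled
  to \<open>B x x = 1\<close>; by polarisation \<open>B\<close> vanishes on the complement, which is therefore the kernel of \<open>B\<close>.
  A degenerate form is thus covered as well: the residual of a vector lies in the kernel.\<close>

lemma orthonormal_set_exists:
  fixes B :: "'b \<Rightarrow> 'b \<Rightarrow> 'k"
  assumes W: "subspace W"
    and sym: "\<And>x y. x \<in> W \<Longrightarrow> y \<in> W \<Longrightarrow> B x y = B y x"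
    and add: "\<And>x y z. x \<in> W \<Longrightarrow> y \<in> W \<Longrightarrow> z \<in> W \<Longrightarrow> B (x + y) z = B x z + B y z"
    and scale: "\<And>c x z. x \<in> W \<Longrightarrow> z \<in> W \<Longrightarrow> B (c *s x) z = c * B x z"
  shows "\<exists>E. finite E \<and> E \<subseteq> W \<and> (\<forall>e\<in>E. \<forall>e'\<in>E. B e e' = (if e = e' then 1 else 0)) \<and>
    (\<forall>w\<in>W. \<forall>z\<in>W. B (w - (\<Sum>e\<in>E. B w e *s e)) z = 0)"
proof -
  let ?P = "\<lambda>E. finite E \<and> E \<subseteq> W \<and> (\<forall>e\<in>E. \<forall>e'\<in>E. B e e' = (if e = e' then 1 else 0))"
  have zero: "B 0 z = 0" if "z \<in> W" for z
    using scale[OF that that, of 0] by simp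
  have sum: "B (\<Sum>e\<in>E. u e *s e) z = (\<Sum>e\<in>E. u e * B e z)" if "finite E" "E \<subseteq> W" "z \<in> W" for E u z
    using that(1,2)
  proof (induction E)
    case (insert e E)
    then have "(\<Sum>e\<in>E. u e *s e) \<in> W" by (auto intro!: subspace_sum[OF W] subspace_scale[OF W])
    then show ?case using insert by (simp add: add scale that(3) subspace_scale[OF W])
  qed (simp add: zero that(3))
  have coord: "B (\<Sum>e\<in>E. u e *s e) e = u e" if "?P E" "e \<in> E" for E u e
  proof -
    have "B (\<Sum>e\<in>E. u e *s e) e = (\<Sum>e'\<in>E. u e' * B e' e)"
      using that by (intro sum) auto
    also have "\<dots> = (\<Sum>e'\<in>E. if e' = e then u e' else 0)"
      using that by (intro sum.cong) auto
    finally show ?thesis using that by simp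
  qed
  have bound: "card E \<le> dimension" if "?P E" for E
  proof -
    have "independent E"
      using that coord[OF that] zero
      by (intro independent_if_scalars_zero) (auto, metis subsetD)
    then show ?thesis using independent_card_le_dim[of E UNIV] by (simp add: dimension_def)
  qed
  have "\<exists>E. ?P E \<and> (\<forall>E'. ?P E' \<longrightarrow> card E' \<le> card E)"
    by (rule ex_has_greatest_nat[where b = "Suc dimension" and k = "{}"])
      (use bound in \<open>auto simp: less_Suc_eq_le\<close>)
  then obtain E where E: "?P E" and max: "\<And>E'. ?P E' \<Longrightarrow> card E' \<le> card E" by blast
  have "finite E" using E by blast
  define W' where "W' = {w \<in> W. \<forall>e\<in>E. B w e = 0}"
  have sW': "x + y \<in> W'" "c *s x \<in> W'" if "x \<in> W'" "y \<in> W'" for x y c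
    using that E by (auto simp: W'_def add scale subspace_add[OF W] subspace_scale[OF W])
  have isotropic: "B x x = 0" if x: "x \<in> W'" for x
  proof (rule ccontr)
    assume "B x x \<noteq> 0"
    obtain c where c: "c ^ 2 = inverse (B x x)"
      using nth_root_exists[of 2 "inverse (B x x)"] by auto
    define y where "y = c *s x"
    have y: "y \<in> W'" "y \<in> W" using x sW' by (auto simp: y_def W'_def)
    have xW: "x \<in> W" using x by (simp add: W'_def)
    have "B y y = c * (c * B x x)"
      using xW y(2) by (simp add: y_def scale sym[of x "c *s x"])
    also have "\<dots> = 1" using c \<open>B x x \<noteq> 0\<close> by (simp add: power2_eq_square flip: mult.assoc)
    finally have yy: "B y y = 1" .
    have ye: "B y e = 0" "B e y = 0" if "e \<in> E" for e
      using y that E sym[of e y] by (auto simp: W'_def)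
    have "y \<notin> E" using yy ye by force
    moreover have "?P (insert y E)" using E y yy ye \<open>y \<notin> E\<close> by auto
    ultimately show False using max[of "insert y E"] \<open>finite E\<close> by simp
  qed
  have null: "B x y = 0" if "x \<in> W'" "y \<in> W'" for x y
  proof -
    have W: "x \<in> W" "y \<in> W" "x + y \<in> W" using that sW'(1)[OF that] by (auto simp: W'_def)
    have "B (x + y) (x + y) = B x x + B x y + (B y x + B y y)"
      using W sym[of x "x + y"] sym[of y "x + y"] sym[of y x] by (simp add: add)
    then have "B x y + B x y = 0"
      using isotropic that sW'(1) W sym[of y x] by simp
    then show ?thesis by (simp flip: mult_2)
  qed
  have proj: "w - (\<Sum>e\<in>E. B w e *s e) \<in> W'" if w: "w \<in> W" for w
  proof -
    have s: "(\<Sum>e\<in>E. B w e *s e) \<in> W" using E by (auto intro!: subspace_sum[OF W] subspace_scale[OF W])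
    have "B (w - (\<Sum>e\<in>E. B w e *s e)) e = B w e - B (\<Sum>e\<in>E. B w e *s e) e" if "e \<in> E" for e
    proof -
      have eW: "e \<in> W" using E that by blast
      have "B w e = B (w - (\<Sum>e\<in>E. B w e *s e)) e + B (\<Sum>e\<in>E. B w e *s e) e"
        using add[OF subspace_diff[OF W w s] s eW] by simp
      then show ?thesis by simp
    qed
    then show ?thesis using coord[OF E] subspace_diff[OF W w s] by (simp add: W'_def)
  qed
  have "B (w - (\<Sum>e\<in>E. B w e *s e)) z = 0" if w: "w \<in> W" and z: "z \<in> W" for w z
  proof -
    let ?w = "w - (\<Sum>e\<in>E. B w e *s e)" and ?p = "\<Sum>e\<in>E. B z e *s e"
    have p: "?p \<in> W" using E by (auto intro!: subspace_sum[OF W] subspace_scale[OF W])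
    have w': "?w \<in> W'" "?w \<in> W" using proj[OF w] by (auto simp: W'_def)
    have z': "z - ?p \<in> W'" "z - ?p \<in> W" using proj[OF z] by (auto simp: W'_def)
    have "B z ?w = B (z - ?p) ?w + B ?p ?w"
      using add[OF z'(2) p w'(2)] by simp
    also have "B ?p ?w = (\<Sum>e\<in>E. B z e * B e ?w)"
      using E w'(2) by (intro sum) auto
    also have "\<dots> = 0"
    proof (intro sum.neutral ballI)
      fix e assume e: "e \<in> E"
      have "e \<in> W" using e E by blast
      then have "B e ?w = B ?w e" using w'(2) by (rule sym)
      also have "\<dots> = 0" using w'(1) e by (simp add: W'_def)
      finally show "B z e * B e ?w = 0" by simp
    qed
    finally show ?thesis using null[OF z'(1) w'(1)] sym[OF z w'(2)] by simp
  qed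
  then show ?thesis using E by blast
qed

end

section \<open>Operators of the adjoint representation\<close>

locale fd_lie_algebra = lie_algebra scale br + closed_field_space scale Basis
  for scale :: "'k::{alg_closed_field, field_char_0} \<Rightarrow> 'g::ab_group_add \<Rightarrow> 'g"  (infixr \<open>*s\<close> 75)
    and br and Basis
begin

lemma lin_br: "lin (br x)"
  by (rule linI) (simp_all add: br_simps)

lemma br_diff: "br (x - y) z = br x z - br y z" "br x (y - z) = br x y - br x z"
  using br_simps(1)[of "x - y" y z] br_simps(2)[of x "y - z" z] by simp_all

lemma br_sum: "br (sum g A) z = (\<Sum>i\<in>A. br (g i) z)" "br z (sum g A) = (\<Sum>i\<in>A. br z (g i))"
proof -
  have "lin (\<lambda>x. br x z)" by (rule linI) (simp_all add: br_simps)
  then show "br (sum g A) z = (\<Sum>i\<in>A. br (g i) z)" by (rule lin_simps(6))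
qed (rule lin_simps(6)[OF lin_br])

lemma br_br: "br (br x y) z = br x (br y z) - br y (br x z)"
proof -
  have "br x (br y z) + br y (br z x) + br z (br x y) = 0" by (rule jacobi)
  moreover have "br y (br z x) = - br y (br x z)"
    using br_anticomm[of z x] lin_simps(3)[OF lin_br] by simp
  moreover have "br z (br x y) = - br (br x y) z" by (rule br_anticomm)
  ultimately show ?thesis by (simp add: algebra_simps)
qed

text \<open>The operator \<open>ad x - (a + b)\<close> acts on a bracket \<open>[z, v]\<close> by the Leibniz rule with \<open>ad x - a\<close> on
  \<open>z\<close> and \<open>ad x - b\<close> on \<open>v\<close>; after \<open>m + n\<close> steps every term contains a factor that has vanished.\<close>

lemma br_gen_eigenvectors:
  assumes "((\<lambda>v. br x v - a *s v) ^^ m) z = 0" "((\<lambda>v. br x v - b *s v) ^^ n) v = 0"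
  shows "((\<lambda>v. br x v - (a + b) *s v) ^^ (m + n)) (br z v) = 0"
  using assms
proof (induction "m + n" arbitrary: m n z v)
  case 0
  then show ?case by (simp add: br_simps)
next
  case (Suc k)
  let ?A = "\<lambda>a v. br x v - a *s v"
  have lA: "lin (?A a)" for a by (rule lin_shift[OF lin_br])
  show ?case
  proof (cases "m = 0 \<or> n = 0")
    case True
    then have "br z v = 0" using Suc.prems by (auto simp: br_simps)
    then show ?thesis using lin_simps(5)[OF lin_funpow[OF lA]] by simp
  next
    case False
    then obtain m' n' where mn: "m = Suc m'" "n = Suc n'" by (metis not0_implies_Suc)
    have step: "?A (a + b) (br z v) = br (?A a z) v + br z (?A b v)"
      using br_br[of x z v] by (simp add: br_simps br_diff algebra_simps)
    have "(?A (a + b) ^^ (m + n)) (br z v) = (?A (a + b) ^^ k) (?A (a + b) (br z v))"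
      unfolding Suc.hyps(2)[symmetric] funpow_Suc_right by simp
    also have "\<dots> = (?A (a + b) ^^ k) (br (?A a z) v) + (?A (a + b) ^^ k) (br z (?A b v))"
      unfolding step by (rule lin_simps(1)[OF lin_funpow[OF lA]])
    also have "(?A (a + b) ^^ k) (br (?A a z) v) = 0"
    proof -
      have "(?A a ^^ m') (?A a z) = 0"
        using Suc.prems(1) unfolding mn(1) funpow_Suc_right by simp
      then show ?thesis using Suc.hyps(1)[of m' n "?A a z" v] Suc.hyps(2) Suc.prems(2) mn by simp
    qed
    also have "(?A (a + b) ^^ k) (br z (?A b v)) = 0"
    proof -
      have "(?A b ^^ n') (?A b v) = 0"
        using Suc.prems(2) unfolding mn(2) funpow_Suc_right by simp
      then show ?thesis using Suc.hyps(1)[of m n' z "?A b v"] Suc.hyps(2) Suc.prems(1) mn by simp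
    qed
    finally show ?thesis by simp
  qed
qed

definition preserves :: "'g set \<Rightarrow> 'g set \<Rightarrow> bool" where
  "preserves L V \<longleftrightarrow> subspace V \<and> (\<forall>x\<in>L. \<forall>v\<in>V. br x v \<in> V)"

lemma preservesD: "preserves L V \<Longrightarrow> x \<in> L \<Longrightarrow> v \<in> V \<Longrightarrow> br x v \<in> V"
  by (simp add: preserves_def)

lemma preserves_subspace: "preserves L V \<Longrightarrow> subspace V"
  by (simp add: preserves_def)

definition perfect :: "'g set \<Rightarrow> bool" where
  "perfect L \<longleftrightarrow> L \<subseteq> span {br x y | x y. x \<in> L \<and> y \<in> L}"

definition trace_form :: "'g set \<Rightarrow> 'g \<Rightarrow> 'g \<Rightarrow> 'k" where
  "trace_form V x y = trace_on V (\<lambda>v. br x (br y v))"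

text \<open>If \<open>x\<close> were not nilpotent on \<open>V\<close>, it would have an eigenvalue \<open>a \<noteq> 0\<close> there.  Choose \<open>f\<close> with
  \<open>f a \<noteq> 0\<close> and let \<open>Y\<close> be the conjugate operator.  The bracket with \<open>Y\<close> maps \<open>L\<close> to itself, as
  operators on \<open>V\<close> (\<open>deriv\<close>), because \<open>L\<close> is spanned by generalised eigenvectors of \<open>ad x\<close>, on which
  this bracket is the scalar \<open>f c\<close>.  Hence \<open>tr ([u, v] Y) = tr (u [v, Y]) = 0\<close> for \<open>u, v\<close> in \<open>L\<close>
  (\<open>orth\<close>), and \<open>x\<close> is a combination of such brackets.  The positivity of
  \<open>conjugate_operator_exists\<close> now gives \<open>f a = 0\<close>.\<close>

lemma perfect_trace_zero_nilpotent:
  assumes L: "subalgebra L" "perfect L" and LV: "preserves L V"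
    and zero: "\<And>x y. x \<in> L \<Longrightarrow> y \<in> L \<Longrightarrow> trace_form V x y = 0" and x: "x \<in> L"
  shows "\<exists>n. \<forall>v\<in>V. (br x ^^ n) v = 0"
proof -
  have V: "subspace V" and sL: "subspace L" and LL: "\<And>u v. u \<in> L \<Longrightarrow> v \<in> L \<Longrightarrow> br u v \<in> L"
    using LV L(1) by (auto simp: preserves_def subalgebra_def)
  have act: "br u v \<in> V" if "u \<in> L" "v \<in> V" for u v using preservesD[OF LV that] .
  have "\<exists>N>0. (\<forall>k. \<forall>v\<in>V. (br x ^^ k) v = 0 \<longrightarrow> (br x ^^ N) v = 0) \<and>
      {v \<in> V. (br x ^^ N) v = 0} \<inter> (br x ^^ N) ` V = {0} \<and>
      V = {y + z | y z. y \<in> {v \<in> V. (br x ^^ N) v = 0} \<and> z \<in> (br x ^^ N) ` V}"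
    by (rule fitting_decomposition[OF lin_br _ V]) (rule act[OF x])
  then obtain N where N: "\<And>k v. v \<in> V \<Longrightarrow> (br x ^^ k) v = 0 \<Longrightarrow> (br x ^^ N) v = 0"
    and int: "{v \<in> V. (br x ^^ N) v = 0} \<inter> (br x ^^ N) ` V = {0}"
    and V_eq: "V = {y + z | y z. y \<in> {v \<in> V. (br x ^^ N) v = 0} \<and> z \<in> (br x ^^ N) ` V}"
    by blast
  let ?W = "(br x ^^ N) ` V"
  have WV: "?W \<subseteq> V" using funpow_closed[of V "br x"] act[OF x] by blast
  have "?W = {0}"
  proof (rule ccontr)
    assume W: "?W \<noteq> {0}"
    have xW: "br x v \<in> ?W" if "v \<in> ?W" for v
      using that act[OF x] by (auto simp: funpow_swap1)
    obtain a v where v: "v \<in> ?W" "v \<noteq> 0" "br x v = a *s v"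
      by (rule eigenvector_exists[OF lin_br xW subspace_image_lin[OF lin_funpow[OF lin_br] V] W])
    have vV: "v \<in> V" using v(1) WV by blast
    have "a \<noteq> 0"
    proof
      assume "a = 0"
      then have "(br x ^^ N) v = 0" using N[of v 1] v vV by simp
      then show False using int v vV by blast
    qed
    then obtain f :: "'k \<Rightarrow> rat" where f: "\<And>x y. f (x + y) = f x + f y" "\<And>q x. f (of_rat q * x) = q * f x"
      and fa: "f a \<noteq> 0"
      by (rule rational_functional_exists) blast
    have "\<exists>Y. lin Y \<and> (\<forall>v\<in>V. Y v \<in> V) \<and>
        (\<forall>a n. \<forall>v\<in>V. ((\<lambda>v. br x v - a *s v) ^^ n) v = 0 \<longrightarrow> Y v = of_rat (f a) *s v) \<and>
        f (trace_on V (\<lambda>v. br x (Y v))) \<ge> 0 \<and>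
        (f (trace_on V (\<lambda>v. br x (Y v))) = 0 \<longrightarrow>
           (\<forall>a. \<forall>v\<in>V. v \<noteq> 0 \<longrightarrow> br x v = a *s v \<longrightarrow> f a = 0))"
      by (rule conjugate_operator_exists[OF f lin_br V]) (rule act[OF x])
    then obtain Y where Y0: "lin Y" "\<forall>v\<in>V. Y v \<in> V"
      "\<forall>a n. \<forall>v\<in>V. ((\<lambda>v. br x v - a *s v) ^^ n) v = 0 \<longrightarrow> Y v = of_rat (f a) *s v"
      "f (trace_on V (\<lambda>v. br x (Y v))) = 0 \<longrightarrow>
        (\<forall>a. \<forall>v\<in>V. v \<noteq> 0 \<longrightarrow> br x v = a *s v \<longrightarrow> f a = 0)"
      by (elim exE conjE) (rule that)
    have Y: "lin Y" "v \<in> V \<Longrightarrow> Y v \<in> V"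
      "v \<in> V \<Longrightarrow> ((\<lambda>v. br x v - a *s v) ^^ n) v = 0 \<Longrightarrow> Y v = of_rat (f a) *s v" for a n v
      using Y0(1-3) by simp_all
    have fY: "f (trace_on V (\<lambda>v. br x (Y v))) = 0 \<Longrightarrow> f a = 0"
      using Y0(4) vV v(2,3) by blast
    have deriv: "\<exists>z'\<in>L. \<forall>v\<in>V. Y (br z v) - br z (Y v) = br z' v" if z: "z \<in> L" for z
    proof -
      let ?P = "{z. \<exists>z'\<in>L. \<forall>v\<in>V. Y (br z v) - br z (Y v) = br z' v}"
      let ?G = "\<lambda>V. {v \<in> V. \<exists>a n. ((\<lambda>v. br x v - a *s v) ^^ n) v = 0}"
      have "subspace ?P"
      proof (rule subspaceI)
        show "0 \<in> ?P" by (auto intro!: bexI[of _ 0] subspace_0[OF sL] simp: br_simps lin_simps(5)[OF Y(1)])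
      next
        fix z w assume "z \<in> ?P" "w \<in> ?P"
        then obtain z' w' where z': "z' \<in> L" "\<And>v. v \<in> V \<Longrightarrow> Y (br z v) - br z (Y v) = br z' v"
          and w': "w' \<in> L" "\<And>v. v \<in> V \<Longrightarrow> Y (br w v) - br w (Y v) = br w' v" by blast
        have "Y (br (z + w) v) - br (z + w) (Y v) = br (z' + w') v" if "v \<in> V" for v
        proof -
          have "Y (br (z + w) v) - br (z + w) (Y v) =
              (Y (br z v) - br z (Y v)) + (Y (br w v) - br w (Y v))"
            by (simp add: br_simps lin_simps[OF Y(1)])
          then show ?thesis using z'(2)[OF that] w'(2)[OF that] by (simp add: br_simps)
        qed
        then show "z + w \<in> ?P" using subspace_add[OF sL z'(1) w'(1)] by blast
      next
        fix c z assume "z \<in> ?P"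
        then obtain z' where z': "z' \<in> L" "\<And>v. v \<in> V \<Longrightarrow> Y (br z v) - br z (Y v) = br z' v" by blast
        have "Y (br (c *s z) v) - br (c *s z) (Y v) = br (c *s z') v" if "v \<in> V" for v
        proof -
          have "Y (br (c *s z) v) - br (c *s z) (Y v) = c *s (Y (br z v) - br z (Y v))"
            by (simp add: br_simps lin_simps[OF Y(1)] scale_right_diff_distrib)
          then show ?thesis using z'(2)[OF that] by (simp add: br_simps)
        qed
        then show "c *s z \<in> ?P" using subspace_scale[OF sL z'(1)] by blast
      qed
      moreover have "?G L \<subseteq> ?P"
      proof
        fix z assume "z \<in> ?G L"
        then obtain c m where z: "z \<in> L" "((\<lambda>v. br x v - c *s v) ^^ m) z = 0"
          by (elim CollectE conjE exE) (rule that)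
        have "Y (br z v) - br z (Y v) = br (of_rat (f c) *s z) v" if v: "v \<in> V" for v
        proof (rule lin_eq_on_span[where b = "?G V" and S = "\<lambda>v. Y (br z v) - br z (Y v)"
              and T = "br (of_rat (f c) *s z)" and x = v])
          show "lin (\<lambda>v. Y (br z v) - br z (Y v))"
            by (rule lin_diff[OF lin_comp[OF Y(1) lin_br] lin_comp[OF lin_br Y(1)]])
          show "lin (br (of_rat (f c) *s z))" by (rule lin_br)
          show "v \<in> span (?G V)"
            using gen_eigenvectors_span[OF lin_br V, of x] act[OF x] v by blast
        next
          fix u assume "u \<in> ?G V"
          then obtain b n where u: "u \<in> V" "((\<lambda>v. br x v - b *s v) ^^ n) u = 0"
            by (elim CollectE conjE exE) (rule that)
          have "Y (br z u) = of_rat (f (c + b)) *s br z u"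
            by (rule Y(3)[OF act[OF z(1) u(1)] br_gen_eigenvectors[OF z(2) u(2)]])
          moreover have "Y u = of_rat (f b) *s u" by (rule Y(3)[OF u])
          ultimately show "Y (br z u) - br z (Y u) = br (of_rat (f c) *s z) u"
            by (simp add: br_simps f(1) of_rat_add scale_left_distrib)
        qed
        then show "z \<in> ?P" using subspace_scale[OF sL z(1)] by blast
      qed
      ultimately have "span (?G L) \<subseteq> ?P" by (rule span_minimal[rotated])
      then show ?thesis using gen_eigenvectors_span[OF lin_br sL, of x] LL[OF x] z by blast
    qed
    have orth: "trace_on V (\<lambda>w. br (br u v) (Y w)) = 0" if uv: "u \<in> L" "v \<in> L" for u v
    proof -
      obtain v' where v': "v' \<in> L" "\<And>w. w \<in> V \<Longrightarrow> Y (br v w) - br v (Y w) = br v' w"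
        using deriv[OF uv(2)] by blast
      have lins: "lin (\<lambda>w. br u (br v (Y w)))" "lin (\<lambda>w. br v (br u (Y w)))" "lin (\<lambda>w. br u (Y w))"
        "lin (\<lambda>w. br u (Y (br v w)))"
        using lin_comp[OF lin_br lin_comp[OF lin_br Y(1)]] lin_comp[OF lin_br Y(1)]
          lin_comp[OF lin_br lin_comp[OF Y(1) lin_br]] by blast+
      have "trace_on V (\<lambda>w. br (br u v) (Y w)) = trace_on V (\<lambda>w. br u (br v (Y w)) - br v (br u (Y w)))"
        by (simp add: br_br)
      also have "\<dots> = trace_on V (\<lambda>w. br u (br v (Y w))) - trace_on V (\<lambda>w. br v (br u (Y w)))"
        by (rule trace_on_diff[OF V lins(1) _ lins(2)]) (use act uv Y(2) in auto)
      also have "trace_on V (\<lambda>w. br v (br u (Y w))) = trace_on V (\<lambda>w. br u (Y (br v w)))"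
        by (rule trace_on_commute[OF V lin_br _ lins(3)]) (use act uv Y(2) in auto)
      also have "trace_on V (\<lambda>w. br u (br v (Y w))) - trace_on V (\<lambda>w. br u (Y (br v w))) =
          trace_on V (\<lambda>w. br u (br v (Y w)) - br u (Y (br v w)))"
        by (rule trace_on_diff[OF V lins(1) _ lins(4), symmetric]) (use act uv Y(2) in auto)
      also have "\<dots> = trace_on V (\<lambda>w. (- 1) *s br u (br v' w))"
      proof (rule trace_on_cong[OF V])
        fix w assume "w \<in> V"
        have "br u (br v (Y w)) - br u (Y (br v w)) = - br u (Y (br v w) - br v (Y w))"
          by (simp add: br_diff)
        then show "br u (br v (Y w)) - br u (Y (br v w)) = (- 1) *s br u (br v' w)"
          using v'(2)[OF \<open>w \<in> V\<close>] by simp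
      qed
      also have "\<dots> = (- 1) * trace_on V (\<lambda>w. br u (br v' w))"
        by (rule trace_on_scale[OF V lin_comp[OF lin_br lin_br]]) (use act uv(1) v'(1) in auto)
      also have "\<dots> = 0"
        using zero[OF uv(1) v'(1)] by (simp add: trace_form_def)
      finally show ?thesis .
    qed
    have lY: "lin (\<lambda>w. br z (Y w))" for z by (rule lin_comp[OF lin_br Y(1)])
    have "subspace {z \<in> L. trace_on V (\<lambda>w. br z (Y w)) = 0}"
    proof (rule subspaceI)
      show "0 \<in> {z \<in> L. trace_on V (\<lambda>w. br z (Y w)) = 0}"
        by (simp add: br_simps subspace_0[OF sL] trace_on_zero[OF V])
    next
      fix z w assume zw: "z \<in> {z \<in> L. trace_on V (\<lambda>w. br z (Y w)) = 0}" "w \<in> {z \<in> L. trace_on V (\<lambda>w. br z (Y w)) = 0}"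
      then have "trace_on V (\<lambda>v. br z (Y v) + br w (Y v)) = trace_on V (\<lambda>v. br z (Y v)) + trace_on V (\<lambda>v. br w (Y v))"
        by (intro trace_on_add V lY) (use act Y(2) in auto)
      then show "z + w \<in> {z \<in> L. trace_on V (\<lambda>w. br z (Y w)) = 0}"
        using zw subspace_add[OF sL] by (simp add: br_simps)
    next
      fix c z assume z: "z \<in> {z \<in> L. trace_on V (\<lambda>w. br z (Y w)) = 0}"
      then have "trace_on V (\<lambda>v. c *s br z (Y v)) = c * trace_on V (\<lambda>v. br z (Y v))"
        by (intro trace_on_scale V lY) (use act Y(2) in auto)
      then show "c *s z \<in> {z \<in> L. trace_on V (\<lambda>w. br z (Y w)) = 0}"
        using z subspace_scale[OF sL] by (simp add: br_simps)
    qed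
    then have "span {br u v | u v. u \<in> L \<and> v \<in> L} \<subseteq> {z \<in> L. trace_on V (\<lambda>w. br z (Y w)) = 0}"
      by (intro span_minimal) (use LL orth in auto)
    then have "trace_on V (\<lambda>w. br x (Y w)) = 0" using L(2) x by (auto simp: perfect_def)
    moreover have "f 0 = 0" using f(1)[of 0 0] by simp
    ultimately show False using fY fa by simp
  qed
  then have "(br x ^^ N) v = 0" if "v \<in> V" for v using that by blast
  then show ?thesis by blast
qed

section \<open>The theorems of Engel and Cartan\<close>

text \<open>If \<open>x\<close> is nilpotent on \<open>V\<close> modulo \<open>U\<close>, then \<open>ad x\<close> is nilpotent on \<open>L\<close> modulo the elements that map
  \<open>V\<close> into \<open>U\<close>: expanding \<open>[(ad x)\<^sup>k y, v]\<close> gives terms \<open>x\<^sup>i y x\<^sup>j v\<close> with \<open>i + j = k\<close>, and for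
  \<open>k = 2n\<close> one of \<open>i, j\<close> is at least \<open>n\<close>.  The extra exponents \<open>i, j\<close> in the statement are what the
  induction on \<open>k\<close> needs.\<close>

lemma preserves_powers:
  assumes U: "preserves L U" and V: "preserves L V" and UV: "U \<subseteq> V" and L: "subalgebra L"
    and x: "x \<in> L" "\<And>v. v \<in> V \<Longrightarrow> (br x ^^ n) v \<in> U"
    and y: "y \<in> L" and v: "v \<in> V" and ij: "i + j + k \<ge> 2 * n"
  shows "(br x ^^ i) (br ((br x ^^ k) y) ((br x ^^ j) v)) \<in> U"
  using ij
proof (induction k arbitrary: i j)
  case 0
  have xV: "(br x ^^ j) w \<in> V" if "w \<in> V" for w j
    by (rule funpow_closed[OF preservesD[OF V x(1)] that])
  have xU: "(br x ^^ j) w \<in> U" if "w \<in> U" for w j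
    by (rule funpow_closed[OF preservesD[OF U x(1)] that])
  have big: "(br x ^^ j) w \<in> U" if "w \<in> V" "j \<ge> n" for w j
  proof -
    have "(br x ^^ j) w = (br x ^^ (j - n)) ((br x ^^ n) w)"
      using that(2) by (metis comp_apply funpow_add le_add_diff_inverse2)
    then show ?thesis using xU x(2)[OF that(1)] by simp
  qed
  show ?case
  proof (cases "i \<ge> n")
    case True
    have "br y ((br x ^^ j) v) \<in> V" by (rule preservesD[OF V y xV[OF v]])
    then show ?thesis using big True by simp
  next
    case False
    then have "(br x ^^ j) v \<in> U" using 0 by (intro big v) simp
    then show ?thesis using xU preservesD[OF U y] by simp
  qed
next
  case (Suc k)
  let ?y = "(br x ^^ k) y" and ?v = "(br x ^^ j) v"
  have "br (br x ?y) ?v = br x (br ?y ?v) - br ?y (br x ?v)" by (rule br_br)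
  then have "(br x ^^ i) (br (br x ?y) ?v) = (br x ^^ i) (br x (br ?y ?v)) - (br x ^^ i) (br ?y (br x ?v))"
    using lin_simps(2)[OF lin_funpow[OF lin_br]] by simp
  moreover have "(br x ^^ i) (br x (br ?y ?v)) \<in> U"
    using Suc.IH[of "Suc i" j] Suc.prems by (simp add: funpow_swap1)
  moreover have "(br x ^^ i) (br ?y (br x ?v)) \<in> U"
    using Suc.IH[of i "Suc j"] Suc.prems by simp
  ultimately show ?case
    using subspace_diff[OF preserves_subspace[OF U]] by simp
qed

text \<open>Engel's theorem for the action of \<open>L\<close> on \<open>V / U\<close>, phrased without the quotient.  This relative form
  makes the induction close: for a maximal proper subalgebra \<open>K\<close> containing the elements that act as
  zero, it applies to \<open>K\<close> acting on \<open>L / K\<close> and yields \<open>z\<close> outside \<open>K\<close> with \<open>[K, z] \<subseteq> K\<close>, so that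
  \<open>L\<close> is spanned by \<open>K\<close> and \<open>z\<close>.  It also applies to \<open>K\<close> acting on \<open>V / U\<close>; the vectors killed
  by \<open>K\<close> modulo \<open>U\<close> are stable under \<open>z\<close>, and applying \<open>z\<close> repeatedly to one outside \<open>U\<close>, the last
  vector before \<open>U\<close> is reached is killed by \<open>L\<close> modulo \<open>U\<close>.\<close>

theorem engel_relative:
  assumes "subalgebra L" "preserves L U" "preserves L V" "U \<subseteq> V" "U \<noteq> V"
    and "\<And>x. x \<in> L \<Longrightarrow> \<exists>n. \<forall>v\<in>V. (br x ^^ n) v \<in> U"
  shows "\<exists>v\<in>V - U. \<forall>x\<in>L. br x v \<in> U"
  using assms
proof (induction "dim L" arbitrary: L U V rule: less_induct)
  case less
  note L = less.prems(1) and U = less.prems(2) and V = less.prems(3) and UV = less.prems(4,5)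
    and nil = less.prems(6)
  have sL: "subspace L" and LL: "\<And>x y. x \<in> L \<Longrightarrow> y \<in> L \<Longrightarrow> br x y \<in> L"
    using L by (auto simp: subalgebra_def)
  note sU = preserves_subspace[OF U] and sV = preserves_subspace[OF V]
  define I where "I = {x \<in> L. \<forall>v\<in>V. br x v \<in> U}"
  have sI: "subspace I"
    by (rule subspaceI) (auto simp: I_def br_simps subspace_0[OF sL] subspace_0[OF sU]
        subspace_add[OF sL] subspace_add[OF sU] subspace_scale[OF sL] subspace_scale[OF sU])
  have LI: "br x y \<in> I" if "x \<in> L" "y \<in> I" for x y
    using that LL preservesD[OF V that(1)] preservesD[OF U that(1)]
    by (auto simp: I_def br_br intro!: subspace_diff[OF sU])
  show ?case
  proof (cases "I = L")
    case True
    obtain v where "v \<in> V - U" using UV by blast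
    moreover have "\<forall>x\<in>L. br x v \<in> U" using True \<open>v \<in> V - U\<close> by (auto simp: I_def)
    ultimately show ?thesis by blast
  next
    case False
    let ?P = "\<lambda>K. subalgebra K \<and> I \<subseteq> K \<and> K \<subseteq> L \<and> K \<noteq> L"
    have IP: "?P I" using sI LI False by (auto simp: subalgebra_def I_def)
    have "\<exists>K. ?P K \<and> (\<forall>K'. ?P K' \<longrightarrow> dim K' \<le> dim K)"
      by (rule ex_has_greatest_nat[where b = "Suc dimension" and k = I])
        (use IP in \<open>auto simp: dim_subset_UNIV less_Suc_eq_le\<close>)
    then obtain K where K: "subalgebra K" "I \<subseteq> K" "K \<subseteq> L" "K \<noteq> L"
      and max: "\<And>K'. ?P K' \<Longrightarrow> dim K' \<le> dim K" by blast
    have sK: "subspace K" and KK: "\<And>x y. x \<in> K \<Longrightarrow> y \<in> K \<Longrightarrow> br x y \<in> K"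
      using K by (auto simp: subalgebra_def)
    have dimK: "dim K < dim L"
      using K(3,4) dim_psubset[of K L] span_eq_iff[THEN iffD2, OF sK] span_eq_iff[THEN iffD2, OF sL]
      by (simp only: psubset_eq) simp
    have nilK: "\<exists>n. \<forall>y\<in>L. (br x ^^ n) y \<in> K" if x: "x \<in> K" for x
    proof -
      obtain n where n: "\<forall>v\<in>V. (br x ^^ n) v \<in> U" using nil x K(3) by blast
      have "(br x ^^ (2 * n)) y \<in> I" if y: "y \<in> L" for y
      proof -
        have "(br x ^^ (2 * n)) y \<in> L"
          by (rule funpow_closed[OF LL y]) (use x K(3) in auto)
        moreover have "br ((br x ^^ (2 * n)) y) v \<in> U" if "v \<in> V" for v
          using preserves_powers[OF U V UV(1) L, of x n y v 0 0 "2 * n"] n x y that K(3) by auto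
        ultimately show ?thesis by (simp add: I_def)
      qed
      then show ?thesis using K(2) by blast
    qed
    have "\<exists>z\<in>L - K. \<forall>x\<in>K. br x z \<in> K"
    proof (rule less.hyps[OF dimK K(1) _ _ K(3,4) nilK])
      show "preserves K K" "preserves K L" using sK sL KK LL K(3) by (auto simp: preserves_def)
    qed
    then obtain z where z: "z \<in> L" "z \<notin> K" "\<And>x. x \<in> K \<Longrightarrow> br x z \<in> K" by blast
    define K' where "K' = span (insert z K)"
    have K'_eq: "K' = {x. \<exists>c. x - c *s z \<in> K}"
      unfolding K'_def span_insert using sK by (simp only: span_eq_iff[THEN iffD2])
    have K'L: "K' \<subseteq> L" unfolding K'_def using z(1) K(3) sL by (intro span_minimal) auto
    have "K' = L"
    proof (rule ccontr)
      assume "K' \<noteq> L"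
      have "br x y \<in> K'" if xy: "x \<in> K'" "y \<in> K'" for x y
      proof -
        obtain c d where cd: "x - c *s z \<in> K" "y - d *s z \<in> K" using xy unfolding K'_eq by blast
        let ?x = "x - c *s z" and ?y = "y - d *s z"
        have "br x y = br ?x ?y + (d *s br ?x z - c *s br ?y z)"
          using br_anticomm[of z y] by (simp add: br_diff br_simps br_self algebra_simps)
        moreover have "br ?x ?y \<in> K" "br ?x z \<in> K" "br ?y z \<in> K" using cd KK z(3) by auto
        ultimately have "br x y \<in> K" by (simp add: subspace_add[OF sK] subspace_diff[OF sK] subspace_scale[OF sK])
        then show ?thesis unfolding K'_def using span_superset by blast
      qed
      then have "?P K'"
        using K'L \<open>K' \<noteq> L\<close> K(2) span_superset[of "insert z K"] by (auto simp: subalgebra_def K'_def)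
      then have "dim K' \<le> dim K" by (rule max)
      moreover have "K \<subseteq> K'" "z \<in> K'" unfolding K'_def using span_superset by blast+
      ultimately have "K = K'" using subspace_dim_equal[OF sK, of K'] by (simp add: K'_def)
      then show False using \<open>z \<in> K'\<close> z(2) by simp
    qed
    have "\<exists>v\<in>V - U. \<forall>x\<in>K. br x v \<in> U"
    proof (rule less.hyps[OF dimK K(1) _ _ UV])
      show "preserves K U" "preserves K V" using U V K(3) by (auto simp: preserves_def)
      show "\<exists>n. \<forall>v\<in>V. (br x ^^ n) v \<in> U" if "x \<in> K" for x using nil K(3) that by blast
    qed
    then obtain v where v: "v \<in> V" "v \<notin> U" "\<And>x. x \<in> K \<Longrightarrow> br x v \<in> U" by blast
    let ?Q = "\<lambda>i. (br z ^^ i) v \<in> U"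
    obtain n where "\<forall>v\<in>V. (br z ^^ n) v \<in> U" using nil z(1) by blast
    then have "?Q n" using v(1) by blast
    define m where "m = (LEAST i. ?Q i)"
    have "?Q m" unfolding m_def by (rule LeastI) fact
    have "m \<noteq> 0"
    proof
      assume "m = 0"
      then show False using \<open>?Q m\<close> v(2) by simp
    qed
    then obtain l where l: "m = Suc l" by (cases m) auto
    have "\<not> ?Q l" using not_less_Least[of l ?Q] l by (simp add: m_def)
    have K_iter: "(br z ^^ i) v \<in> V \<and> (\<forall>x\<in>K. br x ((br z ^^ i) v) \<in> U)" for i
    proof (induction i)
      case (Suc i)
      let ?w = "(br z ^^ i) v"
      have "br x (br z ?w) \<in> U" if "x \<in> K" for x
      proof -
        have "br x (br z ?w) = br (br x z) ?w + br z (br x ?w)" by (simp add: br_br)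
        then show ?thesis
          using Suc z(3)[OF that] that preservesD[OF U z(1)] by (simp add: subspace_add[OF sU])
      qed
      then show ?case using Suc preservesD[OF V z(1)] by simp
    qed (use v in auto)
    let ?w = "(br z ^^ l) v"
    have "br x ?w \<in> U" if "x \<in> L" for x
    proof -
      have "x \<in> K'" using that \<open>K' = L\<close> by simp
      then obtain c where c: "x - c *s z \<in> K" unfolding K'_eq by blast
      have "br x ?w = br (x - c *s z) ?w + c *s br z ?w" by (simp add: br_diff br_simps)
      moreover have "br z ?w \<in> U" using \<open>?Q m\<close> l by simp
      ultimately show ?thesis
        using K_iter[of l] c by (simp add: subspace_add[OF sU] subspace_scale[OF sU])
    qed
    then show ?thesis using K_iter[of l] \<open>\<not> ?Q l\<close> by blast
  qed
qed

text \<open>Let \<open>U\<close> be the space of vectors killed by \<open>L\<close>.  If \<open>U \<noteq> V\<close>, Engel's theorem gives \<open>v\<close> outside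
  \<open>U\<close> with \<open>[L, v] \<subseteq> U\<close>; then all brackets \<open>[x, y]\<close> kill \<open>v\<close>, and as \<open>L\<close> is perfect \<open>v\<close> lies in \<open>U\<close>.\<close>

lemma perfect_trace_zero_trivial:
  assumes L: "subalgebra L" "perfect L" and LV: "preserves L V"
    and zero: "\<And>x y. x \<in> L \<Longrightarrow> y \<in> L \<Longrightarrow> trace_form V x y = 0"
    and "x \<in> L" "v \<in> V"
  shows "br x v = 0"
proof -
  define U where "U = {v \<in> V. \<forall>x\<in>L. br x v = 0}"
  note sV = preserves_subspace[OF LV]
  have sL: "subspace L" using L(1) by (simp add: subalgebra_def)
  have sU: "subspace U"
    by (rule subspaceI) (auto simp: U_def br_simps subspace_0[OF sV] subspace_add[OF sV] subspace_scale[OF sV])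
  have "U = V"
  proof (rule ccontr)
    assume "U \<noteq> V"
    have "\<exists>v\<in>V - U. \<forall>x\<in>L. br x v \<in> U"
    proof (rule engel_relative[OF L(1) _ LV _ \<open>U \<noteq> V\<close>])
      show "preserves L U" using sU by (auto simp: preserves_def U_def br_simps subspace_0[OF sV])
      show "U \<subseteq> V" by (auto simp: U_def)
      show "\<exists>n. \<forall>v\<in>V. (br x ^^ n) v \<in> U" if "x \<in> L" for x
        using perfect_trace_zero_nilpotent[OF L LV zero that] subspace_0[OF sU] by metis
    qed
    then obtain v where v: "v \<in> V" "v \<notin> U" "\<And>x. x \<in> L \<Longrightarrow> br x v \<in> U" by blast
    have "subspace {x. br x v = 0}"
      by (rule subspaceI) (simp_all add: br_simps)
    moreover have "br (br x y) v = 0" if "x \<in> L" "y \<in> L" for x y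
      using v(3) that by (auto simp: br_br U_def)
    ultimately have "span {br x y | x y. x \<in> L \<and> y \<in> L} \<subseteq> {x. br x v = 0}"
      by (intro span_minimal) auto
    then have "v \<in> U" using L(2) v(1) by (auto simp: U_def perfect_def)
    then show False using v(2) by simp
  qed
  then show ?thesis using assms(5,6) by (auto simp: U_def)
qed

lemma derived_series_subalgebra:
  assumes "subalgebra K"
  shows "subalgebra (derived_series n K) \<and> derived_series (Suc n) K \<subseteq> derived_series n K"
proof -
  have sub: "derived_series (Suc n) K \<subseteq> derived_series n K" if D: "subalgebra (derived_series n K)" for n
    unfolding derived_series.simps
  proof (rule span_minimal)
    show "subspace (derived_series n K)" using D by (simp only: subalgebra_def)
    show "{br x y | x y. x \<in> derived_series n K \<and> y \<in> derived_series n K} \<subseteq> derived_series n K"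
      using D unfolding subalgebra_def by blast
  qed
  have "subalgebra (derived_series n K)"
  proof (induction n)
    case (Suc n)
    have "br x y \<in> derived_series (Suc n) K"
      if xy: "x \<in> derived_series (Suc n) K" "y \<in> derived_series (Suc n) K" for x y
    proof -
      have "x \<in> derived_series n K" "y \<in> derived_series n K"
        using xy[THEN subsetD[OF sub[OF Suc]]] .
      then show ?thesis unfolding derived_series.simps by (intro span_base) blast
    qed
    moreover have "subspace (derived_series (Suc n) K)" by simp
    ultimately show ?case unfolding subalgebra_def by blast
  qed (simp add: assms)
  with sub show ?thesis by blast
qed

lemma derived_series_stabilizes:
  assumes K: "subalgebra K"
  obtains n where "perfect (derived_series n K)"
proof -
  let ?D = "\<lambda>n. derived_series n K"
  note D = derived_series_subalgebra[OF K]
  define n where "n = (ARG_MIN (\<lambda>n. dim (?D n)) n. True)"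
  have "dim (?D n) \<le> dim (?D (Suc n))"
    unfolding n_def by (rule arg_min_nat_le) simp
  then have "?D (Suc n) = ?D n"
    using D[of n] D[of "Suc n"] unfolding subalgebra_def by (intro subspace_dim_equal) blast+
  then have "?D n \<subseteq> ?D (Suc n)" by (rule equalityD2)
  then show thesis
    by (intro that[of n]) (simp only: perfect_def derived_series.simps)
qed

lemma derived_series_subset:
  assumes "subalgebra K"
  shows "derived_series n K \<subseteq> K"
proof (induction n)
  case 0
  show ?case by simp
next
  case (Suc n)
  show ?case
    by (rule subset_trans[OF conjunct2[OF derived_series_subalgebra[OF assms]] Suc])
qed

text \<open>The derived series ends in a perfect subalgebra.  It acts trivially on the whole algebra, so its own
  derived algebra is zero.\<close>

theorem cartan_solvable:
  assumes K: "subalgebra K" and zero: "\<And>x y. x \<in> K \<Longrightarrow> y \<in> K \<Longrightarrow> trace_form UNIV x y = 0"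
  shows "solvable K"
proof -
  obtain n where n: "perfect (derived_series n K)" using derived_series_stabilizes[OF K] .
  let ?L = "derived_series n K"
  have L: "subalgebra ?L" and LK: "?L \<subseteq> K"
    using derived_series_subalgebra[OF K, of n] derived_series_subset[OF K, of n] by simp_all
  have "br x y = 0" if "x \<in> ?L" for x y
  proof (rule perfect_trace_zero_trivial[OF L n])
    show "preserves ?L UNIV" by (simp add: preserves_def)
    show "trace_form UNIV u v = 0" if "u \<in> ?L" "v \<in> ?L" for u v
      using zero that LK by (meson subsetD)
  qed (use that in auto)
  then have "{br x y | x y. x \<in> ?L \<and> y \<in> ?L} \<subseteq> {0}" by blast
  then have "derived_series (Suc n) K \<subseteq> {0}"
    by (simp only: derived_series.simps span_minimal subspace_single_0)
  moreover have "0 \<in> derived_series (Suc n) K" by (simp add: span_zero)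
  ultimately show ?thesis unfolding solvable_def by blast
qed

section \<open>Trace forms and ideals of a semisimple algebra\<close>

lemma trace_form_sym:
  assumes "preserves L V" "x \<in> L" "y \<in> L"
  shows "trace_form V x y = trace_form V y x"
  unfolding trace_form_def
  by (rule trace_on_commute[OF preserves_subspace[OF assms(1)] lin_br _ lin_br])
    (use preservesD[OF assms(1)] assms in auto)

lemma trace_form_add:
  assumes "preserves L V" "x \<in> L" "y \<in> L" "z \<in> L"
  shows "trace_form V (x + y) z = trace_form V x z + trace_form V y z"
  unfolding trace_form_def br_simps
  by (rule trace_on_add[OF preserves_subspace[OF assms(1)] lin_comp[OF lin_br lin_br] _ lin_comp[OF lin_br lin_br]])
    (use preservesD[OF assms(1)] assms in auto)

lemma trace_form_scale:
  assumes "preserves L V" "x \<in> L" "z \<in> L"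
  shows "trace_form V (c *s x) z = c * trace_form V x z"
  unfolding trace_form_def br_simps
  by (rule trace_on_scale[OF preserves_subspace[OF assms(1)] lin_comp[OF lin_br lin_br]])
    (use preservesD[OF assms(1)] assms in auto)

text \<open>As operators, \<open>ad (D x)\<close> is the commutator of \<open>D\<close> and \<open>ad x\<close>; the trace of a product is invariant
  under exchanging its two factors.\<close>

lemma trace_form_derivation:
  assumes V: "preserves L V" and L: "x \<in> L" "z \<in> L" "D x \<in> L" "D z \<in> L"
    and D: "lin D" "\<And>v. v \<in> V \<Longrightarrow> D v \<in> V" "\<And>u v. D (br u v) = br (D u) v + br u (D v)"
  shows "trace_form V (D x) z = - trace_form V x (D z)"
proof -
  note sV = preserves_subspace[OF V] and act = preservesD[OF V]
  have lins: "lin (\<lambda>v. D (br x (br z v)))" "lin (\<lambda>v. br x (D (br z v)))" "lin (\<lambda>v. br x (br z (D v)))"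
    "lin (\<lambda>v. br x (br z v))"
    using lin_comp[OF D(1) lin_comp[OF lin_br lin_br]] lin_comp[OF lin_br lin_comp[OF D(1) lin_br]]
      lin_comp[OF lin_br lin_comp[OF lin_br D(1)]] lin_comp[OF lin_br lin_br] by blast+
  have "trace_form V (D x) z = trace_on V (\<lambda>v. D (br x (br z v)) - br x (D (br z v)))"
    unfolding trace_form_def by (rule trace_on_cong[OF sV]) (simp add: D(3))
  also have "\<dots> = trace_on V (\<lambda>v. D (br x (br z v))) - trace_on V (\<lambda>v. br x (D (br z v)))"
    by (rule trace_on_diff[OF sV lins(1) _ lins(2)]) (use D(2) act L in auto)
  also have "trace_on V (\<lambda>v. D (br x (br z v))) = trace_on V (\<lambda>v. br x (br z (D v)))"
    by (rule trace_on_commute[OF sV D(1,2) lins(4)]) (use act L in auto)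
  also have "trace_on V (\<lambda>v. br x (br z (D v))) - trace_on V (\<lambda>v. br x (D (br z v))) =
      - (trace_on V (\<lambda>v. br x (D (br z v))) - trace_on V (\<lambda>v. br x (br z (D v))))"
    by simp
  also have "trace_on V (\<lambda>v. br x (D (br z v))) - trace_on V (\<lambda>v. br x (br z (D v))) =
      trace_on V (\<lambda>v. br x (D (br z v)) - br x (br z (D v)))"
    by (rule trace_on_diff[OF sV lins(2) _ lins(3), symmetric]) (use D(2) act L in auto)
  also have "\<dots> = trace_form V x (D z)"
    unfolding trace_form_def by (rule trace_on_cong[OF sV]) (simp add: D(3) br_simps)
  finally show ?thesis .
qed

lemma trace_form_invariant:
  assumes L: "subalgebra L" and V: "preserves L V" and "x \<in> L" "y \<in> L" "z \<in> L"
  shows "trace_form V (br x y) z = - trace_form V y (br x z)"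
  by (rule trace_form_derivation[OF V, where D = "br x"])
    (use assms preservesD[OF V] in \<open>auto simp: subalgebra_def lin_br br_br\<close>)

lemma trace_form_radical_ideal:
  assumes L: "subalgebra L" and V: "preserves L V" and I: "ideal L I"
  shows "ideal L {x \<in> I. \<forall>y\<in>I. trace_form V x y = 0}"
  unfolding ideal_def
proof (intro conjI ballI)
  have sI: "subspace I" and IL: "I \<subseteq> L" and br_I: "\<And>x y. x \<in> L \<Longrightarrow> y \<in> I \<Longrightarrow> br x y \<in> I"
    using I by (auto simp: ideal_def)
  have VI: "preserves I V" using V IL by (auto simp: preserves_def)
  have "trace_form V 0 y = 0" if "y \<in> I" for y
    using trace_form_scale[OF VI that that, of 0] by simp
  then show "subspace {x \<in> I. \<forall>y\<in>I. trace_form V x y = 0}"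
    by (intro subspaceI) (auto simp: subspace_0[OF sI] subspace_add[OF sI] subspace_scale[OF sI]
        trace_form_add[OF VI] trace_form_scale[OF VI])
  show "{x \<in> I. \<forall>y\<in>I. trace_form V x y = 0} \<subseteq> L" using IL by blast
  fix x y assume x: "x \<in> L" and y: "y \<in> {x \<in> I. \<forall>y\<in>I. trace_form V x y = 0}"
  have "trace_form V (br x y) z = 0" if z: "z \<in> I" for z
  proof -
    have "trace_form V (br x y) z = - trace_form V y (br x z)"
      by (rule trace_form_invariant[OF L V x]) (use y z IL in auto)
    then show ?thesis using y br_I[OF x z] by simp
  qed
  then show "br x y \<in> {x \<in> I. \<forall>y\<in>I. trace_form V x y = 0}"
    using br_I[OF x] y by blast
qed

lemma ideal_subalgebra: "ideal L I \<Longrightarrow> subalgebra I"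
  by (auto simp: ideal_def subalgebra_def)

lemma finite_dimensional: "finite_dimensional_vector_space scale Basis" ..

lemma preserves_UNIV: "preserves L UNIV"
  by (simp add: preserves_def)

text \<open>The elements of \<open>I\<close> orthogonal to \<open>I\<close> form an ideal of \<open>s\<close>, which is solvable by Cartan's criterion
  for the action on the whole algebra, and so lies in the radical of \<open>s\<close>.\<close>

lemma semisimple_form_nondegenerate:
  assumes s: "subalgebra s" "semisimple s" and I: "ideal s I"
    and x: "x \<in> I" "\<And>y. y \<in> I \<Longrightarrow> trace_form UNIV x y = 0"
  shows "x = 0"
proof -
  let ?N = "{x \<in> I. \<forall>y\<in>I. trace_form UNIV x y = 0}"
  have N: "ideal s ?N" by (rule trace_form_radical_ideal[OF s(1) preserves_UNIV I])
  then have "solvable ?N"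
    by (intro cartan_solvable ideal_subalgebra[OF N]) auto
  then have "?N \<subseteq> radical s"
    using radical_greatest(3)[OF finite_dimensional s(1) N] by blast
  then show ?thesis using x s(2) by (auto simp: semisimple_def)
qed

text \<open>Let \<open>D = [I, I]\<close>, an ideal.  The Killing form of the ambient algebra is nondegenerate on \<open>D\<close>, so \<open>D\<close>
  has an orthonormal basis, and any \<open>w\<close> in \<open>I\<close> is the sum of an element of \<open>D\<close> and some \<open>x\<close> in \<open>I\<close>
  orthogonal to \<open>D\<close>.  For \<open>y, z\<close> in \<open>I\<close>, the form pairs \<open>[y, x]\<close> with \<open>z\<close> as, up to sign,
  \<open>x\<close> with \<open>[y, z]\<close>, which gives zero; the form being nondegenerate on \<open>I\<close> too, \<open>[y, x] = 0\<close>.  So \<open>x\<close> is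
  central in \<open>I\<close>.  The centre of \<open>I\<close> is a solvable ideal, hence
  zero.\<close>

lemma semisimple_ideal_perfect:
  assumes s: "subalgebra s" "semisimple s" and I: "ideal s I"
  shows "perfect I"
proof -
  define D where "D = span {br x y | x y. x \<in> I \<and> y \<in> I}"
  have sI: "subspace I" and Is: "I \<subseteq> s" and br_I: "\<And>x y. x \<in> s \<Longrightarrow> y \<in> I \<Longrightarrow> br x y \<in> I"
    using I by (auto simp: ideal_def)
  have DI: "D \<subseteq> I" unfolding D_def by (rule span_minimal[OF _ sI]) (use br_I Is in auto)
  have sD: "subspace D" by (simp add: D_def)
  have gen: "br x y \<in> D" if "x \<in> I" "y \<in> I" for x y
    unfolding D_def using that by (intro span_base) blast
  have "br x y \<in> D" if x: "x \<in> s" and y: "y \<in> D" for x y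
  proof -
    have "subspace {y. br x y \<in> D}"
      by (rule subspaceI) (auto simp: br_simps subspace_0[OF sD] subspace_add[OF sD] subspace_scale[OF sD])
    moreover have "br x (br u v) \<in> D" if "u \<in> I" "v \<in> I" for u v
    proof -
      have "br x (br u v) = br (br x u) v + br u (br x v)" by (simp add: br_br)
      then show ?thesis using gen that br_I[OF x] by (simp add: subspace_add[OF sD])
    qed
    ultimately have "span {br x y | x y. x \<in> I \<and> y \<in> I} \<subseteq> {y. br x y \<in> D}"
      by (intro span_minimal) auto
    then show ?thesis using y unfolding D_def by blast
  qed
  then have D: "ideal s D" using sD DI Is by (auto simp: ideal_def)
  let ?B = "trace_form UNIV"
  note pr = preserves_UNIV[of D]
  have "\<exists>E. finite E \<and> E \<subseteq> D \<and> (\<forall>e\<in>E. \<forall>e'\<in>E. ?B e e' = (if e = e' then 1 else 0)) \<and>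
      (\<forall>w\<in>D. \<forall>z\<in>D. ?B (w - (\<Sum>e\<in>E. ?B w e *s e)) z = 0)"
    by (rule orthonormal_set_exists[OF sD trace_form_sym[OF pr] trace_form_add[OF pr] trace_form_scale[OF pr]])
  then obtain E where E1: "finite E" "E \<subseteq> D" "\<forall>e\<in>E. \<forall>e'\<in>E. ?B e e' = (if e = e' then 1 else 0)"
    "\<forall>w\<in>D. \<forall>z\<in>D. ?B (w - (\<Sum>e\<in>E. ?B w e *s e)) z = 0" by (elim exE conjE) (rule that)
  note E = E1(1,2) E1(3,4)[THEN bspec, THEN bspec]
  have sumD: "(\<Sum>e\<in>E. u e *s e) \<in> D" for u
    using E(2) by (auto intro!: subspace_sum[OF sD] subspace_scale[OF sD])
  have expand: "w = (\<Sum>e\<in>E. ?B w e *s e)" if "w \<in> D" for w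
    using semisimple_form_nondegenerate[OF s D, of "w - (\<Sum>e\<in>E. ?B w e *s e)"]
      subspace_diff[OF sD that sumD] E(4)[OF that] by simp
  have "w \<in> D" if w: "w \<in> I" for w
  proof -
    define x where "x = w - (\<Sum>e\<in>E. ?B w e *s e)"
    have xI: "x \<in> I" unfolding x_def using w sumD DI by (intro subspace_diff[OF sI]) auto
    have B_sum: "?B (\<Sum>e\<in>F. u e *s e) z = (\<Sum>e\<in>F. u e * ?B e z)" if "finite F" for F u z
      using that
    proof (induction F)
      case empty
      then show ?case using trace_form_scale[OF preserves_UNIV, of 0 UNIV z 0] by simp
    next
      case (insert e F)
      then show ?case
        using trace_form_add[OF preserves_UNIV, of "u e *s e" UNIV "\<Sum>e\<in>F. u e *s e" z]
          trace_form_scale[OF preserves_UNIV, of e UNIV z "u e"] by simp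
    qed
    have xE: "?B x e = 0" if e: "e \<in> E" for e
    proof -
      have "?B w e = ?B x e + ?B (\<Sum>e\<in>E. ?B w e *s e) e"
        using trace_form_add[OF preserves_UNIV, of x UNIV "\<Sum>e\<in>E. ?B w e *s e" e] by (simp add: x_def)
      also have "?B (\<Sum>e\<in>E. ?B w e *s e) e = (\<Sum>e'\<in>E. if e' = e then ?B w e' else 0)"
        unfolding B_sum[OF E(1)] using E(3) e by (intro sum.cong) auto
      also have "\<dots> = ?B w e" using E(1) e by simp
      finally show ?thesis by simp
    qed
    have xD: "?B x d = 0" if "d \<in> D" for d
    proof -
      have "?B x d = ?B d x" by (rule trace_form_sym[OF preserves_UNIV[of UNIV]]) auto
      also have "\<dots> = ?B (\<Sum>e\<in>E. ?B d e *s e) x"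
        by (rule arg_cong[where f = "\<lambda>d. ?B d x", OF expand[OF that]])
      also have "\<dots> = (\<Sum>e\<in>E. ?B d e * ?B e x)" by (rule B_sum[OF E(1)])
      also have "\<dots> = (\<Sum>e\<in>E. ?B d e * ?B x e)"
        by (intro sum.cong refl) (metis UNIV_I preserves_UNIV trace_form_sym)
      also have "\<dots> = 0" by (simp add: xE)
      finally show ?thesis .
    qed
    let ?Z = "{x \<in> I. \<forall>y\<in>I. br x y = 0}"
    have "br y x = 0" if y: "y \<in> I" for y
    proof (rule semisimple_form_nondegenerate[OF s I])
      show "br y x \<in> I" using y xI br_I Is by blast
      fix z assume z: "z \<in> I"
      have "?B (br y x) z = - ?B x (br y z)"
        by (rule trace_form_invariant[OF _ preserves_UNIV, of UNIV]) (auto simp: subalgebra_def)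
      then show "?B (br y x) z = 0" using xD gen[OF y z] by simp
    qed
    then have "x \<in> ?Z" using xI br_anticomm[of x] by auto
    have Z: "ideal s ?Z"
      unfolding ideal_def
    proof (intro conjI ballI)
      show "subspace ?Z"
        by (rule subspaceI) (auto simp: br_simps subspace_0[OF sI] subspace_add[OF sI] subspace_scale[OF sI])
      show "?Z \<subseteq> s" using Is by blast
      fix u z assume u: "u \<in> s" and z: "z \<in> ?Z"
      then have "br (br u z) y = 0" if "y \<in> I" for y
        using that br_I[OF u] by (auto simp: br_br br_simps)
      then show "br u z \<in> ?Z" using br_I[OF u] z by blast
    qed
    have "{br x y | x y. x \<in> ?Z \<and> y \<in> ?Z} \<subseteq> {0}" by auto
    then have "derived_series 1 ?Z \<subseteq> {0}" by (simp add: span_minimal)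
    then have "derived_series 1 ?Z = {0}" by (auto simp: span_zero)
    then have "solvable ?Z" unfolding solvable_def by blast
    then have "?Z \<subseteq> radical s"
      using radical_greatest(3)[OF finite_dimensional s(1) Z] by blast
    then have "x = 0" using \<open>x \<in> ?Z\<close> s(2) by (auto simp: semisimple_def)
    then have "w = (\<Sum>e\<in>E. ?B w e *s e)" by (simp add: x_def)
    then show ?thesis using sumD[of "?B w"] by (rule ssubst)
  qed
  then show ?thesis unfolding perfect_def D_def by blast
qed

section \<open>The first Whitehead lemma\<close>

text \<open>The kernel \<open>K\<close> of the trace form of \<open>V\<close> is an ideal of \<open>s\<close>, hence perfect, so it acts trivially
  on \<open>V\<close>; consequently the cocycle \<open>f\<close> vanishes on \<open>K\<close> too.  An orthonormal set \<open>E\<close> therefore serves as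
  a basis of \<open>s\<close> for the action on \<open>V\<close> and for \<open>f\<close>.  Let \<open>C = \<Sum> e e\<close> be its Casimir operator and
  \<open>w = \<Sum> [e, f e]\<close>.  Then \<open>C\<close> commutes with \<open>s\<close> and \<open>C (f x) = [x, w]\<close>, so \<open>f\<close> is a coboundary
  wherever \<open>C\<close> is invertible.  Precisely, let \<open>V0\<close> be the part of \<open>V\<close> on which \<open>C\<close> is nilpotent.
  Subtracting a coboundary from \<open>f\<close> moves its values into \<open>V0\<close>, and the induction hypothesis applies
  unless \<open>V0 = V\<close>.  In that case \<open>0 = tr C\<close> is the cardinality of \<open>E\<close>, so \<open>K\<close> is all of \<open>s\<close> and
  \<open>f = 0\<close>.\<close>

theorem whitehead_first:
  assumes s: "subalgebra s" "semisimple s" and V: "preserves s V"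
    and f: "\<And>x. x \<in> s \<Longrightarrow> f x \<in> V" "\<And>x y. x \<in> s \<Longrightarrow> y \<in> s \<Longrightarrow> f (x + y) = f x + f y"
      "\<And>c x. x \<in> s \<Longrightarrow> f (c *s x) = c *s f x"
      "\<And>x y. x \<in> s \<Longrightarrow> y \<in> s \<Longrightarrow> f (br x y) = br x (f y) - br y (f x)"
  shows "\<exists>v\<in>V. \<forall>x\<in>s. f x = br x v"
  using V f
proof (induction "dim V" arbitrary: V f rule: less_induct)
  case less
  note V = less.prems(1) and f = less.prems(2-5)
  note sV = preserves_subspace[OF V] and act = preservesD[OF V]
  have ss: "subspace s" and br_s: "\<And>x y. x \<in> s \<Longrightarrow> y \<in> s \<Longrightarrow> br x y \<in> s"
    using s(1) by (auto simp: subalgebra_def)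
  let ?B = "trace_form V"
  define K where "K = {x \<in> s. \<forall>y\<in>s. ?B x y = 0}"
  have "ideal s s" using ss br_s by (auto simp: ideal_def)
  then have K: "ideal s K" unfolding K_def by (rule trace_form_radical_ideal[OF s(1) V])
  have Ks: "K \<subseteq> s" by (auto simp: K_def)
  have Kperf: "perfect K" by (rule semisimple_ideal_perfect[OF s K])
  have KV: "br x v = 0" if "x \<in> K" "v \<in> V" for x v
  proof (rule perfect_trace_zero_trivial[OF ideal_subalgebra[OF K] Kperf _ _ that])
    show "preserves K V" using V Ks by (auto simp: preserves_def)
    show "trace_form V x y = 0" if "x \<in> K" "y \<in> K" for x y using that by (auto simp: K_def)
  qed
  have f0: "f 0 = 0" using f(3)[of 0 0] subspace_0[OF ss] by simp
  have fK: "f x = 0" if x: "x \<in> K" for x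
  proof -
    have "subspace {x \<in> s. f x = 0}"
      by (rule subspaceI) (auto simp: f0 f subspace_0[OF ss] subspace_add[OF ss] subspace_scale[OF ss])
    moreover have "{br x y | x y. x \<in> K \<and> y \<in> K} \<subseteq> {x \<in> s. f x = 0}"
      using Ks br_s f(1,4) KV by (auto simp: subset_iff)
    ultimately have "span {br x y | x y. x \<in> K \<and> y \<in> K} \<subseteq> {x \<in> s. f x = 0}"
      by (intro span_minimal) auto
    then show ?thesis using Kperf x by (auto simp: perfect_def)
  qed
  have "\<exists>E. finite E \<and> E \<subseteq> s \<and> (\<forall>e\<in>E. \<forall>e'\<in>E. ?B e e' = (if e = e' then 1 else 0)) \<and>
      (\<forall>w\<in>s. \<forall>z\<in>s. ?B (w - (\<Sum>e\<in>E. ?B w e *s e)) z = 0)"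
    by (rule orthonormal_set_exists[OF ss trace_form_sym[OF V] trace_form_add[OF V] trace_form_scale[OF V]])
  then obtain E where E1: "finite E" "E \<subseteq> s" "\<forall>e\<in>E. \<forall>e'\<in>E. ?B e e' = (if e = e' then 1 else 0)"
    "\<forall>w\<in>s. \<forall>z\<in>s. ?B (w - (\<Sum>e\<in>E. ?B w e *s e)) z = 0" by (elim exE conjE) (rule that)
  note E = E1(1,2) E1(3,4)[THEN bspec, THEN bspec]
  have Es: "e \<in> s" if "e \<in> E" for e using E(2) that by blast
  have sum_s: "(\<Sum>e\<in>F. u e *s e) \<in> s" if "F \<subseteq> E" for u F
    using Es that by (auto intro!: subspace_sum[OF ss] subspace_scale[OF ss])
  have residual: "x - (\<Sum>e\<in>E. ?B x e *s e) \<in> K" if "x \<in> s" for x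
    using that E(4) sum_s subspace_diff[OF ss] by (auto simp: K_def)
  have br_expand: "br x v = (\<Sum>e\<in>E. ?B x e *s br e v)" if x: "x \<in> s" and v: "v \<in> V" for x v
  proof -
    have "br x v - br (\<Sum>e\<in>E. ?B x e *s e) v = 0"
      using KV[OF residual[OF x] v] by (simp add: br_diff)
    then show ?thesis by (simp add: br_sum br_simps)
  qed
  have f_sum: "f (\<Sum>e\<in>F. u e *s e) = (\<Sum>e\<in>F. u e *s f e)" if "F \<subseteq> E" for u F
    using finite_subset[OF that E(1)] that
  proof (induction F)
    case (insert e F)
    then show ?case using f(2)[OF subspace_scale[OF ss Es] sum_s] f(3)[OF Es] by simp
  qed (simp add: f0)
  have f_expand: "f x = (\<Sum>e\<in>E. ?B x e *s f e)" if x: "x \<in> s" for x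
  proof -
    let ?p = "\<Sum>e\<in>E. ?B x e *s e"
    have "f x = f (x - ?p) + f ?p"
      using f(2)[of "x - ?p" ?p] subspace_diff[OF ss x] sum_s by simp
    then show ?thesis using fK[OF residual[OF x]] f_sum by simp
  qed
  define C where "C v = (\<Sum>e\<in>E. br e (br e v))" for v
  have lC: "lin C" unfolding C_def by (rule lin_sum) (rule lin_comp[OF lin_br lin_br])
  have CV: "C v \<in> V" if "v \<in> V" for v
    unfolding C_def using that act Es by (intro subspace_sum[OF sV]) auto
  have skew: "?B (br x e) e' = - ?B (br x e') e" if "x \<in> s" "e \<in> E" "e' \<in> E" for x e e'
  proof -
    have "?B (br x e) e' = - ?B e (br x e')"
      by (rule trace_form_invariant[OF s(1) V]) (use that Es in auto)
    also have "?B e (br x e') = ?B (br x e') e"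
      by (rule trace_form_sym[OF V]) (use that Es br_s in auto)
    finally show ?thesis .
  qed
  \<comment> \<open>The tensor \<open>\<Sum> e \<otimes> e\<close> is killed by \<open>x\<close>; here \<open>\<Phi>\<close> is a bilinear map through which it is seen,
    and which may be evaluated by expanding its arguments along \<open>E\<close>.\<close>
  have invariant: "(\<Sum>e\<in>E. \<Phi> (br x e) e + \<Phi> e (br x e)) = 0"
    if x: "x \<in> s" and l: "\<And>a b. a \<in> s \<Longrightarrow> b \<in> E \<Longrightarrow> \<Phi> a b = (\<Sum>e\<in>E. ?B a e *s \<Phi> e b)"
      and r: "\<And>a b. a \<in> E \<Longrightarrow> b \<in> s \<Longrightarrow> \<Phi> a b = (\<Sum>e\<in>E. ?B b e *s \<Phi> a e)"
    for x and \<Phi> :: "'g \<Rightarrow> 'g \<Rightarrow> 'g"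
  proof -
    have "(\<Sum>e\<in>E. \<Phi> (br x e) e) = (\<Sum>e\<in>E. \<Sum>e'\<in>E. ?B (br x e) e' *s \<Phi> e' e)"
      by (intro sum.cong refl l br_s x Es)
    also have "\<dots> = (\<Sum>e'\<in>E. \<Sum>e\<in>E. ?B (br x e) e' *s \<Phi> e' e)" by (rule sum.swap)
    also have "\<dots> = (\<Sum>e'\<in>E. \<Sum>e\<in>E. - (?B (br x e') e *s \<Phi> e' e))"
      by (intro sum.cong refl) (subst skew[OF x], simp_all)
    also have "\<dots> = - (\<Sum>e'\<in>E. \<Phi> e' (br x e'))"
      unfolding sum_negf by (intro arg_cong[where f = uminus] sum.cong refl r[symmetric] br_s x Es)
    finally show ?thesis by (simp add: sum.distrib)
  qed
  have C_comm: "br x (C v) = C (br x v)" if x: "x \<in> s" and v: "v \<in> V" for x v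
  proof -
    have "br x (C v) - C (br x v) = (\<Sum>e\<in>E. br x (br e (br e v)) - br e (br e (br x v)))"
      by (simp add: C_def br_sum sum_subtractf)
    also have "\<dots> = (\<Sum>e\<in>E. br (br x e) (br e v) + br e (br (br x e) v))"
      by (intro sum.cong refl) (simp add: br_br br_diff)
    also have "\<dots> = 0"
    proof (rule invariant[OF x, of "\<lambda>a b. br a (br b v)"])
      show "br a (br b v) = (\<Sum>e\<in>E. ?B a e *s br e (br b v))" if "a \<in> s" "b \<in> E" for a b
        using that act Es v by (intro br_expand) auto
      show "br a (br b v) = (\<Sum>e\<in>E. ?B b e *s br a (br e v))" if "a \<in> E" "b \<in> s" for a b
        unfolding br_expand[OF that(2) v] by (simp add: br_sum br_simps)
    qed
    finally show ?thesis by simp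
  qed
  define w where "w = (\<Sum>e\<in>E. br e (f e))"
  have wV: "w \<in> V" unfolding w_def using act f(1) Es by (intro subspace_sum[OF sV]) auto
  have Cf: "C (f x) = br x w" if x: "x \<in> s" for x
  proof -
    have "br x w = (\<Sum>e\<in>E. (br (br x e) (f e) + br e (f (br x e))) + br e (br e (f x)))"
      unfolding w_def br_sum
    proof (intro sum.cong refl)
      fix e assume e: "e \<in> E"
      have "f (br x e) = br x (f e) - br e (f x)" by (rule f(4)[OF x Es[OF e]])
      then show "br x (br e (f e)) = br (br x e) (f e) + br e (f (br x e)) + br e (br e (f x))"
        by (simp add: br_br br_diff)
    qed
    also have "\<dots> = (\<Sum>e\<in>E. br (br x e) (f e) + br e (f (br x e))) + C (f x)"
      by (simp only: sum.distrib C_def)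
    also have "(\<Sum>e\<in>E. br (br x e) (f e) + br e (f (br x e))) = 0"
    proof (rule invariant[OF x, of "\<lambda>a b. br a (f b)"])
      show "br a (f b) = (\<Sum>e\<in>E. ?B a e *s br e (f b))" if "a \<in> s" "b \<in> E" for a b
        using that f(1) Es by (intro br_expand) auto
      show "br a (f b) = (\<Sum>e\<in>E. ?B b e *s br a (f e))" if "a \<in> E" "b \<in> s" for a b
        by (subst f_expand[OF that(2)]) (simp add: br_sum br_simps)
    qed
    finally show ?thesis by simp
  qed
  have C_pow: "br x ((C ^^ n) v) = (C ^^ n) (br x v)" if "x \<in> s" "v \<in> V" for x v n
    by (induction n) (simp_all add: C_comm that funpow_closed[of V C, OF CV])
  have "\<exists>N>0. (\<forall>k. \<forall>v\<in>V. (C ^^ k) v = 0 \<longrightarrow> (C ^^ N) v = 0) \<and>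
      {v \<in> V. (C ^^ N) v = 0} \<inter> (C ^^ N) ` V = {0} \<and>
      V = {x + y | x y. x \<in> {v \<in> V. (C ^^ N) v = 0} \<and> y \<in> (C ^^ N) ` V}"
    by (rule fitting_decomposition[OF lC CV sV])
  then obtain N where N1: "N > 0" "\<forall>k. \<forall>v\<in>V. (C ^^ k) v = 0 \<longrightarrow> (C ^^ N) v = 0"
    and V_eq: "V = {x + y | x y. x \<in> {v \<in> V. (C ^^ N) v = 0} \<and> y \<in> (C ^^ N) ` V}"
    by (elim exE conjE) (rule that)
  note N = N1(1) N1(2)[THEN spec, THEN bspec, THEN mp]
  define V0 where "V0 = {v \<in> V. (C ^^ N) v = 0}"
  note lCN = lin_funpow[OF lC]
  have sV0: "subspace V0" unfolding V0_def by (rule subspace_kernel_on[OF lCN sV])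
  show ?case
  proof (cases "V0 = V")
    case True
    have "trace_on V C = 0"
      by (rule trace_on_nilpotent[OF lC sV CV]) (use True in \<open>auto simp: V0_def\<close>)
    moreover have "trace_on V C = (\<Sum>e\<in>E. ?B e e)"
      unfolding C_def trace_form_def
      by (rule trace_on_sum[OF sV E(1) lin_comp[OF lin_br lin_br]]) (use act Es in auto)
    moreover have "(\<Sum>e\<in>E. ?B e e) = of_nat (card E)" using E(3) by simp
    ultimately have "E = {}" using E(1) by simp
    then have "f x = br x 0" if "x \<in> s" for x
      using f_expand[OF that] by (simp add: br_simps)
    then show ?thesis using subspace_0[OF sV] by blast
  next
    case False
    have V0V: "V0 \<subseteq> V" by (auto simp: V0_def)
    have V0: "preserves s V0"
      using sV0 act C_pow by (auto simp: preserves_def V0_def br_simps simp flip: C_pow)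
    have dim: "dim V0 < dim V"
      using False V0V dim_psubset[of V0 V] span_eq_iff[THEN iffD2, OF sV0] span_eq_iff[THEN iffD2, OF sV] by auto
    \<comment> \<open>A solution \<open>u\<close> of \<open>(C ^^ Suc N) u = (C ^^ N) w\<close>, so that the coboundary of \<open>u\<close> and \<open>f\<close> agree
      after applying \<open>C ^^ Suc N\<close>.\<close>
    obtain w0 t where wt: "w = w0 + (C ^^ N) t" "w0 \<in> V" "(C ^^ N) w0 = 0" "t \<in> V"
      using wV by (subst (asm) V_eq) blast
    define u where "u = (C ^^ (N - 1)) t"
    have uV: "u \<in> V" unfolding u_def by (rule funpow_closed[OF CV wt(4)])
    have u: "(C ^^ N) w = (C ^^ Suc N) u"
    proof -
      have "(C ^^ N) w = (C ^^ N) ((C ^^ N) t)" using wt(1,3) by (simp add: lin_simps(1)[OF lCN])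
      also have "(C ^^ N) t = C u" using N(1) by (cases N) (simp_all add: u_def)
      also have "(C ^^ N) (C u) = (C ^^ Suc N) u" by (simp add: funpow_swap1)
      finally show ?thesis .
    qed
    define g where "g x = f x - br x u" for x
    have gV: "g x \<in> V0" if x: "x \<in> s" for x
    proof -
      have "(C ^^ Suc N) (f x) = (C ^^ N) (C (f x))" by (simp add: funpow_swap1)
      also have "\<dots> = br x ((C ^^ N) w)" using Cf[OF x] C_pow[OF x wV] by simp
      also have "\<dots> = (C ^^ Suc N) (br x u)" unfolding u by (rule C_pow[OF x uV])
      finally have "(C ^^ Suc N) (g x) = 0" by (simp only: g_def lin_simps(2)[OF lCN]) simp
      moreover have "g x \<in> V" unfolding g_def using x f(1) act uV by (intro subspace_diff[OF sV]) auto
      ultimately show ?thesis using N(2) unfolding V0_def by blast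
    qed
    have "\<exists>v\<in>V0. \<forall>x\<in>s. g x = br x v"
    proof (rule less.hyps[OF dim V0 gV])
      show "g (x + y) = g x + g y" if "x \<in> s" "y \<in> s" for x y
        using f(2)[OF that] by (simp add: g_def br_simps)
      show "g (c *s x) = c *s g x" if "x \<in> s" for c x
        using f(3)[OF that] by (simp add: g_def br_simps scale_right_diff_distrib)
      show "g (br x y) = br x (g y) - br y (g x)" if "x \<in> s" "y \<in> s" for x y
        using f(4)[OF that] by (simp add: g_def br_diff br_br)
    qed
    then obtain v where v: "v \<in> V0" "\<forall>x\<in>s. g x = br x v" by blast
    have "f x = br x (v + u)" if "x \<in> s" for x
      using v(2) that by (simp add: g_def br_simps algebra_simps)
    moreover have "v + u \<in> V" using v(1) uV V0V by (auto intro: subspace_add[OF sV])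
    ultimately show ?thesis by blast
  qed
qed

section \<open>Commutative products whose multiplications are derivations\<close>

lemma radical_UNIV_ideal:
  "subspace (radical UNIV)" "v \<in> radical UNIV \<Longrightarrow> br x v \<in> radical UNIV"
  "v \<in> radical UNIV \<Longrightarrow> br v x \<in> radical UNIV"
proof -
  have "ideal UNIV (radical UNIV)"
    by (rule radical_greatest(1)[OF finite_dimensional]) (simp add: subalgebra_def)
  then show "subspace (radical UNIV)" "v \<in> radical UNIV \<Longrightarrow> br x v \<in> radical UNIV"
    "v \<in> radical UNIV \<Longrightarrow> br v x \<in> radical UNIV"
    using ideal_right[of UNIV "radical UNIV"] by (auto simp: ideal_def)
qed

lemma ABD_structureD:
  assumes "ABD_structure p"
  shows "lin (p x)" "lin (\<lambda>x. p x y)" "p x y = p y x" "p x (br y z) = br (p x y) z + br y (p x z)"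
  using assms by (auto simp: ABD_structure_def)

text \<open>The Killing form of \<open>p x y\<close> and \<open>z\<close> is symmetric in \<open>x, y\<close> and skew in \<open>y, z\<close>.  Moving the
  variables around with these two symmetries returns to the start with the opposite sign.\<close>

lemma ABD_structure_into_radical:
  assumes p: "ABD_structure p"
  shows "p x y \<in> radical UNIV"
proof -
  let ?B = "trace_form UNIV" and ?N = "{x \<in> UNIV. \<forall>y\<in>UNIV. trace_form UNIV x y = 0}"
  note D = ABD_structureD[OF p]
  have sub: "subalgebra UNIV" by (simp add: subalgebra_def)
  have skew: "?B (p x y) z = - ?B (p x z) y" for x y z
  proof -
    have "?B (p x y) z = - ?B y (p x z)"
      by (rule trace_form_derivation[OF preserves_UNIV[of UNIV] _ _ _ _ D(1) _ D(4)]) auto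
    also have "?B y (p x z) = ?B (p x z) y"
      by (rule trace_form_sym[OF preserves_UNIV[of UNIV]]) auto
    finally show ?thesis .
  qed
  have "?B (p x y) z = 0" for z
  proof -
    have "?B (p x y) z = - ?B (p x z) y" by (rule skew)
    also have "\<dots> = - ?B (p z x) y" by (simp only: D(3)[of x z])
    also have "\<dots> = ?B (p z y) x" by (simp only: skew[of z x y] minus_minus)
    also have "\<dots> = ?B (p y z) x" by (simp only: D(3)[of z y])
    also have "\<dots> = - ?B (p y x) z" by (rule skew)
    also have "\<dots> = - ?B (p x y) z" by (simp only: D(3)[of y x])
    finally show ?thesis by simp
  qed
  then have "p x y \<in> ?N" by simp
  moreover have N: "ideal UNIV ?N"
    by (rule trace_form_radical_ideal[OF sub preserves_UNIV]) (simp add: ideal_def)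
  moreover have "solvable ?N"
    by (rule cartan_solvable[OF ideal_subalgebra[OF N]]) auto
  ultimately show ?thesis
    using radical_greatest(3)[OF finite_dimensional sub] by blast
qed

text \<open>The Whitehead lemma gives a vector for every single \<open>x\<close>.  Taking it on a basis and extending
  linearly is harmless, because both sides of \<open>p x a = [a, H x]\<close> are linear in \<open>x\<close>.\<close>

lemma ABD_structure_inner_on_levi:
  assumes p: "ABD_structure p" and s: "levi_subalgebra s"
  obtains H where "lin H" "\<And>x. H x \<in> radical UNIV" "\<And>x a. a \<in> s \<Longrightarrow> p x a = br a (H x)"
proof -
  note D = ABD_structureD[OF p] and R = radical_UNIV_ideal
  have s': "subalgebra s" "semisimple s" using s by (auto simp: levi_subalgebra_def)
  have "\<exists>v\<in>radical UNIV. \<forall>a\<in>s. p x a = br a v" for x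
  proof (rule whitehead_first[OF s'])
    show "preserves s (radical UNIV)" using R by (auto simp: preserves_def)
    show "p x (br a b) = br a (p x b) - br b (p x a)" for a b
      using D(4)[of x a b] br_anticomm[of "p x a" b] by simp
  qed (use ABD_structure_into_radical[OF p] lin_simps[OF D(1)] in auto)
  then obtain h where h: "h x \<in> radical UNIV" "a \<in> s \<Longrightarrow> p x a = br a (h x)" for x a by metis
  interpret vp: vector_space_pair scale scale ..
  obtain H where H: "lin H" "\<And>x. x \<in> Basis \<Longrightarrow> H x = h x"
    using vp.linear_independent_extend[OF independent_Basis, of h] by blast
  have all: "x \<in> span Basis" for x by (simp add: span_Basis)
  show thesis
  proof (rule that[OF H(1)])
    have "subspace {x. H x \<in> radical UNIV}"
      by (rule subspaceI) (simp_all add: lin_simps[OF H(1)] subspace_0[OF R(1)] subspace_add[OF R(1)] subspace_scale[OF R(1)])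
    then have "span Basis \<subseteq> {x. H x \<in> radical UNIV}"
      by (rule span_minimal[rotated]) (use H(2) h(1) in auto)
    then show "H x \<in> radical UNIV" for x using all by blast
    show "p x a = br a (H x)" if "a \<in> s" for x a
      by (rule lin_eq_on_span[OF D(2) lin_comp[OF lin_br H(1)] _ all]) (simp add: H(2) h(2)[OF that])
  qed
qed

text \<open>The Leibniz rule passes to sums in each of the three entries and is preserved when the entries
  of the bracket are exchanged, so a case with an entry of the bracket in \<open>R\<close> and one in \<open>S\<close> is
  needed in one order only.\<close>

lemma leibniz_of_components:
  assumes p: "\<And>x. lin (p x)" "\<And>y. lin (\<lambda>x. p x y)"
    and gen: "\<And>x. \<exists>a\<in>S. \<exists>r\<in>R. x = a + r"
    and SSS: "\<And>a b c. a \<in> S \<Longrightarrow> b \<in> S \<Longrightarrow> c \<in> S \<Longrightarrow> p a (br b c) = br (p a b) c + br b (p a c)"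
    and SSR: "\<And>a b t. a \<in> S \<Longrightarrow> b \<in> S \<Longrightarrow> t \<in> R \<Longrightarrow> p a (br b t) = br (p a b) t + br b (p a t)"
    and SRR: "\<And>a q t. a \<in> S \<Longrightarrow> q \<in> R \<Longrightarrow> t \<in> R \<Longrightarrow> p a (br q t) = br (p a q) t + br q (p a t)"
    and RSS: "\<And>r b c. r \<in> R \<Longrightarrow> b \<in> S \<Longrightarrow> c \<in> S \<Longrightarrow> p r (br b c) = br (p r b) c + br b (p r c)"
    and RSR: "\<And>r b t. r \<in> R \<Longrightarrow> b \<in> S \<Longrightarrow> t \<in> R \<Longrightarrow> p r (br b t) = br (p r b) t + br b (p r t)"
    and RRR: "\<And>r q t. r \<in> R \<Longrightarrow> q \<in> R \<Longrightarrow> t \<in> R \<Longrightarrow> p r (br q t) = br (p r q) t + br q (p r t)"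
  shows "p x (br y z) = br (p x y) z + br y (p x z)"
proof -
  let ?L = "\<lambda>x y z. p x (br y z) = br (p x y) z + br y (p x z)"
  have swap: "?L x z y" if "?L x y z" for x y z
    using that br_anticomm[of z y] br_anticomm[of "p x z" y] br_anticomm[of z "p x y"]
      lin_simps(3)[OF p(1)] by simp
  have addx: "?L (x + x') y z" if "?L x y z" "?L x' y z" for x x' y z
    using that by (simp add: lin_simps(1)[OF p(2)] br_simps)
  have addz: "?L x y (z + z')" if "?L x y z" "?L x y z'" for x y z z'
    using that by (simp add: lin_simps(1)[OF p(1)] br_simps)
  have addy: "?L x (y + y') z" if "?L x y z" "?L x y' z" for x y y' z
    by (rule swap[OF addz[OF swap[OF that(1)] swap[OF that(2)]]])
  obtain a r where x: "a \<in> S" "r \<in> R" "x = a + r" using gen by blast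
  obtain b q where y: "b \<in> S" "q \<in> R" "y = b + q" using gen by blast
  obtain c t where z: "c \<in> S" "t \<in> R" "z = c + t" using gen by blast
  have comp: "?L u (b + q) (c + t)" if "?L u b c" "?L u b t" "?L u c q" "?L u q t" for u
    by (rule addy[OF addz[OF that(1,2)] addz[OF swap[OF that(3)] that(4)]])
  show ?thesis
    unfolding x(3) y(3) z(3)
  proof (rule addx)
    show "?L a (b + q) (c + t)" using x y z by (intro comp SSS SSR SRR)
    show "?L r (b + q) (c + t)" using x y z by (intro comp RSS RSR RRR)
  qed
qed

end

theorem proposition3p1:
  fixes scale :: "'k::{alg_closed_field, field_char_0} \<Rightarrow> 'g::ab_group_add \<Rightarrow> 'g"
    and br :: "'g \<Rightarrow> 'g \<Rightarrow> 'g"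
    and B \<s> R :: "'g set"
    and \<phi> :: "'g \<Rightarrow> 'g \<Rightarrow> 'g"
    and p :: "'g \<Rightarrow> 'g \<Rightarrow> 'g"  (infixl \<open>\<diamondop>\<close> 70)
  assumes "lie_algebra scale br"
    and "finite_dimensional_vector_space scale B"
    and "lie_algebra.levi_subalgebra scale br \<s>"
    and R_eq: "R = lie_algebra.radical scale br UNIV"
    and \<phi>_eq: "\<phi> = lie_algebra.ad_radical scale br"
  shows "lie_algebra.ABD_structure scale br (\<diamondop>) \<longleftrightarrow>
    (\<exists>F G \<Delta>.
       lie_algebra.linear_on scale \<s> R F \<and>
       lie_algebra.linear_on scale R R G \<and>
       lie_algebra.linear_into_Der scale br R \<Delta> \<and>
       (\<forall>a\<in>\<s>. \<forall>a'\<in>\<s>. \<forall>r\<in>R. \<forall>r'\<in>R.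
          (a + r) \<diamondop> (a' + r') = \<phi> a (F a') + \<phi> a (G r') + \<phi> a' (G r) + \<Delta> r r') \<and>
       (\<forall>a\<in>\<s>. \<forall>a'\<in>\<s>. \<phi> a (F a') = \<phi> a' (F a)) \<and>
       (\<forall>a\<in>\<s>. \<phi> a \<circ> G \<in> lie_algebra.Der scale br R) \<and>
       (\<forall>r\<in>R. \<forall>r'\<in>R. \<Delta> r r' = \<Delta> r' r) \<and>
       (\<forall>a\<in>\<s>. \<forall>a'\<in>\<s>. \<forall>r'\<in>R.
          \<phi> a (G (\<phi> a' r')) = \<phi> a' (\<phi> a (G r')) + br (\<phi> a (F a')) r') \<and>
       (\<forall>a'\<in>\<s>. \<forall>r\<in>R. \<forall>r'\<in>R.
          \<Delta> r (\<phi> a' r') = \<phi> a' (\<Delta> r r') + br (\<phi> a' (G r)) r'))"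
    (is "_ \<longleftrightarrow> (\<exists>F G \<Delta>. ?C F G \<Delta>)")
proof -
  interpret fd_lie_algebra scale br B
    by (intro fd_lie_algebra.intro closed_field_space.intro assms(1,2))
  have levi: "levi_subalgebra \<s>" by fact
  have "x \<in> {a + r | a r. a \<in> \<s> \<and> r \<in> R}" for x
    using levi by (simp only: levi_subalgebra_def R_eq UNIV_I)
  then have \<s>: "subalgebra \<s>" "\<And>x. \<exists>a\<in>\<s>. \<exists>r\<in>R. x = a + r"
    using levi by (auto simp only: levi_subalgebra_def) blast
  have s_sub: "subspace \<s>" and s_br: "\<And>x y. x \<in> \<s> \<Longrightarrow> y \<in> \<s> \<Longrightarrow> br x y \<in> \<s>"
    using \<s>(1) by (auto simp: subalgebra_def)
  note R = radical_UNIV_ideal[folded R_eq]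
  have phi: "\<phi> a v = br a v" if "v \<in> R" for a v
    using that by (simp add: \<phi>_eq ad_radical_def R_eq)
  note s0 = subspace_0[OF s_sub] and R0 = subspace_0[OF R(1)]
  show ?thesis
  proof
    assume p: "ABD_structure (\<diamondop>)"
    note D = ABD_structureD[OF p]
    have pR: "x \<diamondop> y \<in> R" for x y using ABD_structure_into_radical[OF p] by (simp add: R_eq)
    obtain H where H: "lin H" "\<And>x. H x \<in> R" "\<And>x a. a \<in> \<s> \<Longrightarrow> x \<diamondop> a = br a (H x)"
      by (rule ABD_structure_inner_on_levi[OF p levi, folded R_eq]) blast
    have H': "a \<diamondop> x = br a (H x)" if "a \<in> \<s>" for x a
      using H(3)[OF that, of x] D(3)[of a x] by simp
    have phiH: "\<phi> a (H x) = br a (H x)" for a x by (rule phi[OF H(2)])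
    have "?C H H (\<diamondop>)"
    proof (intro conjI ballI)
      show "linear_on \<s> R H" "linear_on R R H"
        using H(2) by (auto simp: linear_on_def lin_simps[OF H(1)])
      show "linear_into_Der R (\<diamondop>)"
        using pR by (auto simp: linear_into_Der_def Der_def linear_on_def lin_simps[OF D(1)]
            lin_simps[OF D(2)] D(4))
      show "(a + r) \<diamondop> (a' + r') = \<phi> a (H a') + \<phi> a (H r') + \<phi> a' (H r) + r \<diamondop> r'"
        if "a \<in> \<s>" "a' \<in> \<s>" for a a' r r'
        by (simp add: lin_simps(1)[OF D(1)] lin_simps(1)[OF D(2)] phiH H(3)[OF that(2), of r] H'[OF that(1)])
      show "\<phi> a (H a') = \<phi> a' (H a)" if "a \<in> \<s>" "a' \<in> \<s>" for a a'
        using H(3)[OF that(2), of a] H'[OF that(1), of a'] by (simp add: phiH)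
      show "\<phi> a \<circ> H \<in> Der R" if "a \<in> \<s>" for a
      proof -
        have "\<phi> a \<circ> H = (\<diamondop>) a" using H'[OF that] by (auto simp: phiH)
        then show ?thesis using pR by (auto simp: Der_def linear_on_def lin_simps[OF D(1)] D(4))
      qed
      show "r \<diamondop> r' = r' \<diamondop> r" for r r' by (rule D(3))
      show "\<phi> a (H (\<phi> a' r')) = \<phi> a' (\<phi> a (H r')) + br (\<phi> a (H a')) r'"
        if "a \<in> \<s>" "a' \<in> \<s>" "r' \<in> R" for a a' r'
        using D(4)[of a a' r'] by (simp add: H'[OF that(1)] phiH phi[OF that(3)] phi R(2)[OF H(2)])
      show "r \<diamondop> \<phi> a' r' = \<phi> a' (r \<diamondop> r') + br (\<phi> a' (H r)) r'"
        if "a' \<in> \<s>" "r' \<in> R" for a' r r'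
        using D(4)[of r a' r'] by (simp add: H(3)[OF that(1)] phiH phi[OF that(2)] phi[OF pR])
    qed
    then show "\<exists>F G \<Delta>. ?C F G \<Delta>" by blast
  next
    assume "\<exists>F G \<Delta>. ?C F G \<Delta>"
    then obtain F G \<Delta> where F: "linear_on \<s> R F" and G: "linear_on R R G"
      and \<Delta>: "linear_into_Der R \<Delta>"
      and prod: "\<forall>a\<in>\<s>. \<forall>a'\<in>\<s>. \<forall>r\<in>R. \<forall>r'\<in>R.
          (a + r) \<diamondop> (a' + r') = \<phi> a (F a') + \<phi> a (G r') + \<phi> a' (G r) + \<Delta> r r'"
      and c1: "\<forall>a\<in>\<s>. \<forall>a'\<in>\<s>. \<phi> a (F a') = \<phi> a' (F a)"
      and c2: "\<forall>a\<in>\<s>. \<phi> a \<circ> G \<in> Der R"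
      and c3: "\<forall>r\<in>R. \<forall>r'\<in>R. \<Delta> r r' = \<Delta> r' r"
      and c4: "\<forall>a\<in>\<s>. \<forall>a'\<in>\<s>. \<forall>r'\<in>R.
          \<phi> a (G (\<phi> a' r')) = \<phi> a' (\<phi> a (G r')) + br (\<phi> a (F a')) r'"
      and c5: "\<forall>a'\<in>\<s>. \<forall>r\<in>R. \<forall>r'\<in>R.
          \<Delta> r (\<phi> a' r') = \<phi> a' (\<Delta> r r') + br (\<phi> a' (G r)) r'"
      by (elim exE conjE) (rule that)
    have FR: "F a \<in> R" if "a \<in> \<s>" for a using F that by (auto simp: linear_on_def)
    have GR: "G r \<in> R" if "r \<in> R" for r using G that by (auto simp: linear_on_def)
    have \<Delta>D: "\<Delta> r \<in> Der R" if "r \<in> R" for r using \<Delta> that by (auto simp: linear_into_Der_def)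
    have \<Delta>R: "\<Delta> r r' \<in> R" if "r \<in> R" "r' \<in> R" for r r'
      using \<Delta>D[OF that(1)] that(2) by (auto simp: Der_def linear_on_def)
    have F_lin: "F (a + b) = F a + F b" "F (scale c a) = scale c (F a)" if "a \<in> \<s>" "b \<in> \<s>" for a b c
      using F that by (auto simp: linear_on_def)
    have G_lin: "G (a + b) = G a + G b" "G (scale c a) = scale c (G a)" if "a \<in> R" "b \<in> R" for a b c
      using G that by (auto simp: linear_on_def)
    have \<Delta>_lin: "\<Delta> r (a + b) = \<Delta> r a + \<Delta> r b" "\<Delta> r (scale c a) = scale c (\<Delta> r a)"
      if "r \<in> R" "a \<in> R" "b \<in> R" for r a b c
      using \<Delta>D[OF that(1)] that by (auto simp: Der_def linear_on_def)
    have F0: "F 0 = 0" using F_lin(2)[OF s0 s0, of 0] by simp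
    have G0: "G 0 = 0" using G_lin(2)[OF R0 R0, of 0] by simp
    have prod': "(a + r) \<diamondop> (a' + r') = br a (F a') + br a (G r') + br a' (G r) + \<Delta> r r'"
      if "a \<in> \<s>" "a' \<in> \<s>" "r \<in> R" "r' \<in> R" for a a' r r'
      using prod that by (simp add: phi FR GR)
    have c1': "br a (F a') = br a' (F a)" if "a \<in> \<s>" "a' \<in> \<s>" for a a'
      using c1 that by (simp add: phi FR)
    have comm: "x \<diamondop> y = y \<diamondop> x" for x y
    proof -
      obtain a r where x: "a \<in> \<s>" "r \<in> R" "x = a + r" using \<s>(2) by blast
      obtain b q where y: "b \<in> \<s>" "q \<in> R" "y = b + q" using \<s>(2) by blast
      have "\<Delta> r q = \<Delta> q r" using c3 x(2) y(2) by blast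
      then show ?thesis
        using c1'[OF x(1) y(1)] by (simp add: x(3) y(3) prod' x(1,2) y(1,2))
    qed
    have lin1: "lin ((\<diamondop>) x)" for x
    proof -
      obtain a r where x: "a \<in> \<s>" "r \<in> R" "x = a + r" using \<s>(2) by blast
      show ?thesis
      proof (rule linI)
        fix y z
        obtain b q where y: "b \<in> \<s>" "q \<in> R" "y = b + q" using \<s>(2) by blast
        obtain c t where z: "c \<in> \<s>" "t \<in> R" "z = c + t" using \<s>(2) by blast
        have "x \<diamondop> (y + z) = (a + r) \<diamondop> ((b + c) + (q + t))"
          by (simp add: x(3) y(3) z(3) algebra_simps)
        also have "\<dots> = br a (F (b + c)) + br a (G (q + t)) + br (b + c) (G r) + \<Delta> r (q + t)"
          by (intro prod' x subspace_add[OF s_sub] subspace_add[OF R(1)] y z)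
        also have "\<dots> = x \<diamondop> y + x \<diamondop> z"
          by (simp add: x y z prod' F_lin G_lin \<Delta>_lin br_simps algebra_simps)
        finally show "x \<diamondop> (y + z) = x \<diamondop> y + x \<diamondop> z" .
      next
        fix k y
        obtain b q where y: "b \<in> \<s>" "q \<in> R" "y = b + q" using \<s>(2) by blast
        have "x \<diamondop> (scale k y) = (a + r) \<diamondop> (scale k b + scale k q)"
          by (simp add: x(3) y(3) scale_right_distrib)
        also have "\<dots> = br a (F (scale k b)) + br a (G (scale k q)) + br (scale k b) (G r) + \<Delta> r (scale k q)"
          by (intro prod' x subspace_scale[OF s_sub] subspace_scale[OF R(1)] y)
        also have "\<dots> = scale k (x \<diamondop> y)"
          using F_lin(2)[OF y(1) y(1)] G_lin(2)[OF y(2) y(2)] \<Delta>_lin(2)[OF x(2) y(2) y(2)]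
          by (simp add: x y prod' br_simps scale_right_distrib)
        finally show "x \<diamondop> (scale k y) = scale k (x \<diamondop> y)" .
      qed
    qed
    have lin2: "lin (\<lambda>x. x \<diamondop> y)" for y
    proof -
      have "(\<lambda>x. x \<diamondop> y) = (\<diamondop>) y" by (rule ext) (rule comm)
      then show ?thesis using lin1[of y] by simp
    qed
    have \<Delta>0: "\<Delta> r 0 = 0" "\<Delta> 0 r = 0" if "r \<in> R" for r
      using \<Delta>_lin(2)[OF that R0 R0, of 0] c3 that R0 by auto
    have SS: "a \<diamondop> b = br a (F b)" if "a \<in> \<s>" "b \<in> \<s>" for a b
      using prod'[OF that R0 R0] by (simp add: G0 \<Delta>0 R0 br_simps)
    have SR: "a \<diamondop> r = br a (G r)" if "a \<in> \<s>" "r \<in> R" for a r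
      using prod'[OF that(1) s0 R0 that(2)] that by (simp add: F0 G0 \<Delta>0 br_simps)
    have RR: "r \<diamondop> q = \<Delta> r q" if "r \<in> R" "q \<in> R" for r q
      using prod'[OF s0 s0 that] by (simp add: F0 G0 br_simps)
    have RS: "r \<diamondop> a = br a (G r)" if "a \<in> \<s>" "r \<in> R" for a r
      using SR[OF that] comm[of r a] by simp
    have "x \<diamondop> br y z = br (x \<diamondop> y) z + br y (x \<diamondop> z)" for x y z
    proof (rule leibniz_of_components[OF lin1 lin2 \<s>(2)])
      fix a b c assume s: "a \<in> \<s>" "b \<in> \<s>" "c \<in> \<s>"
      have "a \<diamondop> br b c = br (br b c) (F a)"
        using SS[OF s(1) s_br[OF s(2,3)]] c1'[OF s(1) s_br[OF s(2,3)]] by simp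
      also have "\<dots> = br b (br a (F c)) - br c (br a (F b))"
        using c1'[OF s(1,2)] c1'[OF s(1,3)] by (simp add: br_br)
      also have "\<dots> = br (a \<diamondop> b) c + br b (a \<diamondop> c)"
        using SS[OF s(1,2)] SS[OF s(1,3)] br_anticomm[of "br a (F b)" c] by simp
      finally show "a \<diamondop> br b c = br (a \<diamondop> b) c + br b (a \<diamondop> c)" .
    next
      fix a b t assume s: "a \<in> \<s>" "b \<in> \<s>" "t \<in> R"
      then show "a \<diamondop> br b t = br (a \<diamondop> b) t + br b (a \<diamondop> t)"
        using c4 by (simp add: SS SR R phi FR GR)
    next
      fix a q t assume s: "a \<in> \<s>" "q \<in> R" "t \<in> R"
      then show "a \<diamondop> br q t = br (a \<diamondop> q) t + br q (a \<diamondop> t)"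
        using c2 by (auto simp: SR R phi GR Der_def)
    next
      fix r b c assume s: "r \<in> R" "b \<in> \<s>" "c \<in> \<s>"
      then show "r \<diamondop> br b c = br (r \<diamondop> b) c + br b (r \<diamondop> c)"
        using br_anticomm[of "br b (G r)" c] by (simp add: RS s_br br_br)
    next
      fix r b t assume s: "r \<in> R" "b \<in> \<s>" "t \<in> R"
      then show "r \<diamondop> br b t = br (r \<diamondop> b) t + br b (r \<diamondop> t)"
        using c5 by (simp add: RS RR R phi GR \<Delta>R)
    next
      fix r q t assume s: "r \<in> R" "q \<in> R" "t \<in> R"
      then show "r \<diamondop> br q t = br (r \<diamondop> q) t + br q (r \<diamondop> t)"
        using \<Delta>D[OF s(1)] by (simp add: RR R Der_def)
    qed
    then show "ABD_structure (\<diamondop>)"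
      using lin1 lin2 comm by (simp add: ABD_structure_def)
  qed
qed

end
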